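(* Let $V\subseteq\mathcal V$ be finite, $\mathcal E\in\mathit{DProg}(V)$, $W\subseteq\mathcal V$ finite, $P,Q$ projectors on $\mathcal H_W$, and $xp^p\in\{wp^p,wlp^p\}$. Then: (1) $wp^p.\mathcal E.0=sp^p.\mathcal E.0=0$ and $wlp^p.\mathcal E.I_W=I_W$; (2) if $P\sqsubseteq Q$ then $xp^p.\mathcal E.P\sqsubseteq xp^p.\mathcal E.Q$ and $sp^p.\mathcal E.P\sqsubseteq sp^p.\mathcal E.Q$; (3) $xp^p.\mathcal E.(P\wedge Q)=xp^p.\mathcal E.P\wedge xp^p.\mathcal E.Q$; (4) $sp^p.\mathcal E.(P\wedge Q)\sqsubseteq sp^p.\mathcal E.P\wedge sp^p.\mathcal E.Q$; (5) $xp^p.\mathcal E.P\vee xp^p.\mathcal E.Q\sqsubseteq xp^p.\mathcal E.(P\vee Q)$; (6) $sp^p.\mathcal E.P\vee sp^p.\mathcal E.Q=sp^p.\mathcal E.(P\vee Q)$; (7) if $R$ is a projector on $\mathcal H_{W'}$ with $W'$ finite and $W'\cap(V\cup W)=\emptyset$, then $wp^p.\mathcal E.(Q\otimes R)=(wp^p.\mathcal E.Q)\otimes R$, $sp^p.\mathcal E.(P\otimes R)=(sp^p.\mathcal E.P)\otimes R$, and $wlp^p.\mathcal E.(Q\otimes R)\sqsupseteq(wlp^p.\mathcal E.Q)\otimes R$.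
   Context: $\mathcal V$ is a countably infinite set of qubit variables; $\mathcal H_V=\bigotimes_{q\in V}\mathcal H_q$ with identity $I_V$. $\mathcal D(\mathcal H)$: partial density operators; projectors are identified with their image subspaces, ordered by inclusion $\sqsubseteq$; $\wedge$ is intersection and $\vee$ the span of the union. $\mathit{DProg}(V)$: completely positive trace-nonincreasing super-operators on $\mathcal L(\mathcal H_V)$. Convention: operators and super-operators on subsystems are implicitly extended to larger systems by tensoring with identities; the transformers of a projector on a system $U$ are regarded as projectors on $\mathcal H_{V\cup U}$. For projectors $P,Q$ on $\mathcal H_U$: $\mathcal E\models_{tot}(P,Q)$ iff for all finite $X\supseteq V\cup U$ and $\rho\in\mathcal D(\mathcal H_X)$, ${\rm tr}(P\rho)\le{\rm tr}(Q\mathcal E(\rho))$; $\mathcal E\models_{par}(P,Q)$ iff for all such $X,\rho$, ${\rm tr}(P\rho)\le{\rm tr}(Q\mathcal E(\rho))+{\rm tr}(\rho)-{\rm tr}(\mathcal E(\rho))$. $wp^p.\mathcal E.Q$ is the largest projector $P$ with $\mathcal E\models_{tot}(P,Q)$; $wlp^p.\mathcal E.Q$ the largest projector $P$ with $\mathcal E\models_{par}(P,Q)$; $sp^p.\mathcal E.Q$ the smallest projector $R$ with $\mathcal E\models_{par}(Q,R)$. *)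

theory Defs
  imports Complex_Main "HOL-Library.Complex_Order"
begin

(* Qubit variables: the countably infinite set nat.
   A computational basis state of the register X (finite set of qubit variables)
   is a function nat => bool that is False outside X.
   Operators on H_X are complex matrices indexed by basis states of X,
   represented as functions basis => basis => complex vanishing outside states X.
   Vectors of H_X are functions basis => complex (only values on states X matter). *)

type_synonym basis = "nat \<Rightarrow> bool"
type_synonym vec = "basis \<Rightarrow> complex"
type_synonym op = "basis \<Rightarrow> basis \<Rightarrow> complex"
type_synonym sop = "op \<Rightarrow> op"

definition states :: "nat set \<Rightarrow> basis set" where
  "states X = {f. \<forall>i. i \<notin> X \<longrightarrow> \<not> f i}"

definition restr :: "nat set \<Rightarrow> basis \<Rightarrow> basis" where
  "restr X f = (\<lambda>i. if i \<in> X then f i else False)"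

definition merge :: "nat set \<Rightarrow> basis \<Rightarrow> basis \<Rightarrow> basis" where
  "merge V u a = (\<lambda>i. if i \<in> V then u i else a i)"

definition is_op :: "nat set \<Rightarrow> op \<Rightarrow> bool" where
  "is_op X A \<longleftrightarrow> (\<forall>f g. (f \<notin> states X \<or> g \<notin> states X) \<longrightarrow> A f g = 0)"

definition zero_op :: op where
  "zero_op = (\<lambda>f g. 0)"

definition id_op :: "nat set \<Rightarrow> op" where
  "id_op X = (\<lambda>f g. if f \<in> states X \<and> f = g then 1 else 0)"

definition mult :: "nat set \<Rightarrow> op \<Rightarrow> op \<Rightarrow> op" where
  "mult X A B = (\<lambda>f g. \<Sum>h\<in>states X. A f h * B h g)"

definition adj :: "op \<Rightarrow> op" where
  "adj A = (\<lambda>f g. cnj (A g f))"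

definition trace :: "nat set \<Rightarrow> op \<Rightarrow> complex" where
  "trace X A = (\<Sum>f\<in>states X. A f f)"

definition apply_op :: "nat set \<Rightarrow> op \<Rightarrow> vec \<Rightarrow> vec" where
  "apply_op X A \<phi> = (\<lambda>f. if f \<in> states X then (\<Sum>g\<in>states X. A f g * \<phi> g) else 0)"

definition positive :: "nat set \<Rightarrow> op \<Rightarrow> bool" where
  "positive X A \<longleftrightarrow> is_op X A \<and>
     (\<forall>\<psi>::vec. 0 \<le> (\<Sum>f\<in>states X. \<Sum>g\<in>states X. cnj (\<psi> f) * A f g * \<psi> g))"

definition pdo :: "nat set \<Rightarrow> op \<Rightarrow> bool" where
  "pdo X \<rho> \<longleftrightarrow> positive X \<rho> \<and> trace X \<rho> \<le> 1"

definition is_proj :: "nat set \<Rightarrow> op \<Rightarrow> bool" where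
  "is_proj X P \<longleftrightarrow> is_op X P \<and> mult X P P = P \<and> adj P = P"

definition tensor :: "nat set \<Rightarrow> nat set \<Rightarrow> op \<Rightarrow> op \<Rightarrow> op" where
  "tensor X Y A B = (\<lambda>f g. if f \<in> states (X \<union> Y) \<and> g \<in> states (X \<union> Y)
       then A (restr X f) (restr X g) * B (restr Y f) (restr Y g) else 0)"

definition ext :: "nat set \<Rightarrow> nat set \<Rightarrow> op \<Rightarrow> op" where
  "ext U X A = tensor U (X - U) A (id_op (X - U))"

definition block :: "nat set \<Rightarrow> op \<Rightarrow> basis \<Rightarrow> basis \<Rightarrow> op" where
  "block V \<rho> a b = (\<lambda>u v. if u \<in> states V \<and> v \<in> states V
       then \<rho> (merge V u a) (merge V v b) else 0)"

(* implicit extension E \<otimes> id_{X-V} of a super-operator on L(H_V) to L(H_X):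
   (E \<otimes> id)(\<Sum>_{a,b} \<rho>_{ab} \<otimes> |a><b|) = \<Sum>_{a,b} E(\<rho>_{ab}) \<otimes> |a><b| *)
definition sop_ext :: "nat set \<Rightarrow> nat set \<Rightarrow> sop \<Rightarrow> op \<Rightarrow> op" where
  "sop_ext V X E \<rho> = (\<lambda>f g. if f \<in> states X \<and> g \<in> states X
       then E (block V \<rho> (restr (X - V) f) (restr (X - V) g)) (restr V f) (restr V g)
       else 0)"

definition DProg :: "nat set \<Rightarrow> sop set" where
  "DProg V = {E.
     (\<forall>A. is_op V A \<longrightarrow> is_op V (E A)) \<and>
     (\<forall>A B. is_op V A \<longrightarrow> is_op V B \<longrightarrow>
        E (\<lambda>f g. A f g + B f g) = (\<lambda>f g. E A f g + E B f g)) \<and>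
     (\<forall>c A. is_op V A \<longrightarrow> E (\<lambda>f g. c * A f g) = (\<lambda>f g. c * E A f g)) \<and>
     (\<forall>X \<rho>. finite X \<longrightarrow> V \<subseteq> X \<longrightarrow> positive X \<rho> \<longrightarrow> positive X (sop_ext V X E \<rho>)) \<and>
     (\<forall>\<rho>. positive V \<rho> \<longrightarrow> trace V (E \<rho>) \<le> trace V \<rho>)}"

definition sat_tot :: "nat set \<Rightarrow> sop \<Rightarrow> nat set \<Rightarrow> op \<Rightarrow> nat set \<Rightarrow> op \<Rightarrow> bool" where
  "sat_tot V E UP P UQ Q \<longleftrightarrow>
     (\<forall>X \<rho>. finite X \<longrightarrow> V \<union> UP \<union> UQ \<subseteq> X \<longrightarrow> pdo X \<rho> \<longrightarrow>
        trace X (mult X (ext UP X P) \<rho>) \<le> trace X (mult X (ext UQ X Q) (sop_ext V X E \<rho>)))"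

definition sat_par :: "nat set \<Rightarrow> sop \<Rightarrow> nat set \<Rightarrow> op \<Rightarrow> nat set \<Rightarrow> op \<Rightarrow> bool" where
  "sat_par V E UP P UQ Q \<longleftrightarrow>
     (\<forall>X \<rho>. finite X \<longrightarrow> V \<union> UP \<union> UQ \<subseteq> X \<longrightarrow> pdo X \<rho> \<longrightarrow>
        trace X (mult X (ext UP X P) \<rho>) \<le>
          trace X (mult X (ext UQ X Q) (sop_ext V X E \<rho>))
          + trace X \<rho> - trace X (sop_ext V X E \<rho>))"

definition img :: "nat set \<Rightarrow> op \<Rightarrow> vec set" where
  "img X P = {apply_op X P \<phi> | \<phi>. True}"

definition proj_le :: "nat set \<Rightarrow> op \<Rightarrow> op \<Rightarrow> bool" where
  "proj_le X P Q \<longleftrightarrow> img X P \<subseteq> img X Q"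

definition vspan :: "vec set \<Rightarrow> vec set" where
  "vspan S = {(\<lambda>f. \<Sum>u\<in>T. c u * u f) | T c. finite T \<and> T \<subseteq> S}"

definition proj_of :: "nat set \<Rightarrow> vec set \<Rightarrow> op" where
  "proj_of X S = (THE P. is_proj X P \<and> img X P = S)"

definition proj_meet :: "nat set \<Rightarrow> op \<Rightarrow> op \<Rightarrow> op" where
  "proj_meet X P Q = proj_of X (img X P \<inter> img X Q)"

definition proj_join :: "nat set \<Rightarrow> op \<Rightarrow> op \<Rightarrow> op" where
  "proj_join X P Q = proj_of X (vspan (img X P \<union> img X Q))"

definition wp :: "nat set \<Rightarrow> sop \<Rightarrow> nat set \<Rightarrow> op \<Rightarrow> op" where
  "wp V E U Q = (THE P. is_proj (V \<union> U) P \<and> sat_tot V E (V \<union> U) P U Q \<and>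
     (\<forall>P'. is_proj (V \<union> U) P' \<and> sat_tot V E (V \<union> U) P' U Q \<longrightarrow> proj_le (V \<union> U) P' P))"

definition wlp :: "nat set \<Rightarrow> sop \<Rightarrow> nat set \<Rightarrow> op \<Rightarrow> op" where
  "wlp V E U Q = (THE P. is_proj (V \<union> U) P \<and> sat_par V E (V \<union> U) P U Q \<and>
     (\<forall>P'. is_proj (V \<union> U) P' \<and> sat_par V E (V \<union> U) P' U Q \<longrightarrow> proj_le (V \<union> U) P' P))"

definition sp :: "nat set \<Rightarrow> sop \<Rightarrow> nat set \<Rightarrow> op \<Rightarrow> op" where
  "sp V E U Q = (THE R. is_proj (V \<union> U) R \<and> sat_par V E U Q (V \<union> U) R \<and>
     (\<forall>R'. is_proj (V \<union> U) R' \<and> sat_par V E U Q (V \<union> U) R' \<longrightarrow> proj_le (V \<union> U) R R'))"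

end

theory Submission
  imports Defs
begin

text \<open>
  Put \<open>Y = V \<union> U\<close>. Decomposing a state of a larger register into blocks over \<open>Y\<close> shows that
  satisfaction only has to be tested on \<open>Y\<close>. There, both kinds of satisfaction say that
  \<open>tr (P \<rho>) \<le> tr \<rho> - tr (D \<rho>)\<close> for an effect \<open>0 \<le> D \<le> I\<close>, namely \<open>D = I - E\<^sup>\<dagger>(Q)\<close> (total) or
  \<open>D = E\<^sup>\<dagger>(I - Q)\<close> (partial), and this holds iff \<open>D\<close> vanishes on the image of \<open>P\<close>. Hence the image of
  the weakest liberal precondition of \<open>Q\<close> consists of the \<open>\<psi>\<close> such that \<open>Q\<close> fixes \<open>E(\<psi>\<psi>\<^sup>\<dagger>)\<close>, that of the
  weakest precondition of those \<open>\<psi>\<close> for which moreover \<open>E\<close> preserves the trace of \<open>\<psi>\<psi>\<^sup>\<dagger>\<close>, and that of the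
  strongest postcondition is the span of the columns of all \<open>E(\<psi>\<psi>\<^sup>\<dagger>)\<close> with \<open>\<psi>\<close> in the image of \<open>Q\<close>.
  For the tensor laws, an operator on the ancilla commutes with \<open>E\<close>, and the condition on \<open>Y\<close> can be
  checked on the slices of \<open>\<psi>\<close> along the ancilla.
\<close>

text \<open>The condition on \<open>\<psi>\<close> that \<open>D\<close> yields is quadratic, so it
  is not evident that its solutions form a subspace. Positivity settles this: a positive form that
  vanishes at a vector annihilates the vector, and the null vectors of \<open>D\<close> become a
  linear kernel. Hence a largest \<open>P\<close> exists. The dual map of \<open>E\<close> is never
  built; linear functionals of \<open>\<rho>\<close> take its place. The strongest postcondition is
  tied to the weakest liberal precondition by a Galois connection, \<open>sp Q \<le> R\<close> iff
  \<open>Q \<le> wlp R\<close>, which is why it preserves joins but is only bounded on meets.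
  Partial and total correctness part ways at the ancilla. A program that discards all trace
  satisfies every partial postcondition, so the \<open>wlp\<close> of \<open>Q \<otimes> R\<close>
  can be strictly larger than the product. Total correctness excludes such a loss: positivity also
  kills the cross term between \<open>\<psi>\<close> and its component outside \<open>R\<close>, and
  this forces the component to vanish.\<close>

definition vecs :: "nat set \<Rightarrow> vec set" where
  "vecs X = {\<phi>. \<forall>f. f \<notin> states X \<longrightarrow> \<phi> f = 0}"

definition outer :: "vec \<Rightarrow> vec \<Rightarrow> op" where
  "outer \<phi> \<psi> = (\<lambda>f g. \<phi> f * cnj (\<psi> g))"

definition sesq :: "nat set \<Rightarrow> op \<Rightarrow> vec \<Rightarrow> vec \<Rightarrow> complex" where
  "sesq X A u v = (\<Sum>f\<in>states X. \<Sum>g\<in>states X. cnj (u f) * A f g * v g)"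

definition compl_op :: "nat set \<Rightarrow> op \<Rightarrow> op" where
  "compl_op X P = (\<lambda>f g. id_op X f g - P f g)"

lemma finite_states [simp]: "finite X \<Longrightarrow> finite (states X)"
proof -
  assume "finite X"
  moreover have "states X \<subseteq> (\<lambda>A i. i \<in> A) ` Pow X"
  proof
    fix f assume "f \<in> states X"
    then have "f = (\<lambda>i. i \<in> {i. f i})" "{i. f i} \<in> Pow X"
      by (auto simp: states_def)
    then show "f \<in> (\<lambda>A i. i \<in> A) ` Pow X" by blast
  qed
  ultimately show ?thesis
    by (meson finite_Pow_iff finite_imageI finite_subset)
qed

subsection \<open>Matrix algebra\<close>

lemma is_opD: "is_op X A \<Longrightarrow> f \<notin> states X \<Longrightarrow> A f g = 0"
  "is_op X A \<Longrightarrow> g \<notin> states X \<Longrightarrow> A f g = 0"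
  by (auto simp: is_op_def)

lemma is_op_id [simp]: "is_op X (id_op X)"
  by (auto simp: is_op_def id_op_def)

lemma is_op_zero [simp]: "is_op X zero_op"
  by (auto simp: is_op_def zero_op_def)

lemma is_op_mult [simp]: "is_op X A \<Longrightarrow> is_op X B \<Longrightarrow> is_op X (mult X A B)"
  by (auto simp: is_op_def mult_def)

lemma is_op_adj [simp]: "is_op X A \<Longrightarrow> is_op X (adj A)"
  by (auto simp: is_op_def adj_def)

lemma is_op_compl [simp]: "is_op X P \<Longrightarrow> is_op X (compl_op X P)"
  by (auto simp: is_op_def compl_op_def id_op_def)

lemma is_op_outer [simp]: "u \<in> vecs X \<Longrightarrow> v \<in> vecs X \<Longrightarrow> is_op X (outer u v)"
  by (auto simp: is_op_def outer_def vecs_def)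

lemma is_op_add: "is_op X A \<Longrightarrow> is_op X B \<Longrightarrow> is_op X (\<lambda>f g. A f g + B f g)"
  by (auto simp: is_op_def)

lemma is_op_scale: "is_op X A \<Longrightarrow> is_op X (\<lambda>f g. c * A f g)"
  by (auto simp: is_op_def)

lemma is_op_sum: "(\<And>i. i \<in> I \<Longrightarrow> is_op X (A i)) \<Longrightarrow> is_op X (\<lambda>f g. \<Sum>i\<in>I. A i f g)"
  by (auto simp: is_op_def)

lemma op_eqI:
  assumes "is_op X A" "is_op X B" "\<And>f g. f \<in> states X \<Longrightarrow> g \<in> states X \<Longrightarrow> A f g = B f g"
  shows "A = B"
proof (intro ext)
  fix f g show "A f g = B f g"
    using assms by (cases "f \<in> states X \<and> g \<in> states X") (auto simp: is_op_def)
qed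

lemma mult_assoc: "mult X (mult X A B) C = mult X A (mult X B C)"
proof (intro ext)
  fix f g
  have "mult X (mult X A B) C f g = (\<Sum>h\<in>states X. \<Sum>k\<in>states X. A f k * B k h * C h g)"
    by (simp add: mult_def sum_distrib_right)
  also have "\<dots> = (\<Sum>k\<in>states X. \<Sum>h\<in>states X. A f k * B k h * C h g)"
    by (rule sum.swap)
  also have "\<dots> = mult X A (mult X B C) f g"
    by (simp add: mult_def sum_distrib_left mult.assoc)
  finally show "mult X (mult X A B) C f g = mult X A (mult X B C) f g" .
qed

lemma trace_mult_commute: "trace X (mult X A B) = trace X (mult X B A)"
  unfolding trace_def mult_def
  by (subst sum.swap) (simp add: mult.commute)

lemma mult_id_left: "finite X \<Longrightarrow> is_op X A \<Longrightarrow> mult X (id_op X) A = A"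
  by (rule op_eqI[of X], simp_all)
     (simp add: mult_def id_op_def if_distrib[of "\<lambda>x. x * _"] cong: if_cong)

lemma mult_id_right: "finite X \<Longrightarrow> is_op X A \<Longrightarrow> mult X A (id_op X) = A"
  by (rule op_eqI[of X], simp_all)
     (simp add: mult_def id_op_def if_distrib[of "\<lambda>x. _ * x"] cong: if_cong conj_cong)

lemma mult_compl_left:
  "finite X \<Longrightarrow> is_op X A \<Longrightarrow> mult X (compl_op X P) A = (\<lambda>f g. A f g - mult X P A f g)"
proof -
  assume *: "finite X" "is_op X A"
  have "mult X (compl_op X P) A = (\<lambda>f g. mult X (id_op X) A f g - mult X P A f g)"
    by (simp add: mult_def compl_op_def left_diff_distrib sum_subtractf)
  with * show ?thesis by (simp add: mult_id_left)
qed

lemma mult_compl_right: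
  "finite X \<Longrightarrow> is_op X A \<Longrightarrow> mult X A (compl_op X P) = (\<lambda>f g. A f g - mult X A P f g)"
proof -
  assume *: "finite X" "is_op X A"
  have "mult X A (compl_op X P) = (\<lambda>f g. mult X A (id_op X) f g - mult X A P f g)"
    by (simp add: mult_def compl_op_def right_diff_distrib sum_subtractf)
  with * show ?thesis by (simp add: mult_id_right)
qed

lemma trace_diff: "trace X (\<lambda>f g. A f g - B f g) = trace X A - trace X B"
  by (simp add: trace_def sum_subtractf)

lemma trace_add: "trace X (\<lambda>f g. A f g + B f g) = trace X A + trace X B"
  by (simp add: trace_def sum.distrib)

lemma trace_scale: "trace X (\<lambda>f g. c * A f g) = c * trace X A"
  by (simp add: trace_def sum_distrib_left)

lemma mult_add_right: "mult X A (\<lambda>f g. B f g + C f g) = (\<lambda>f g. mult X A B f g + mult X A C f g)"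
  by (simp add: mult_def distrib_left sum.distrib)

lemma mult_scale_right: "mult X A (\<lambda>f g. c * B f g) = (\<lambda>f g. c * mult X A B f g)"
  by (simp add: mult_def sum_distrib_left mult.left_commute)

lemma adj_mult: "adj (mult X A B) = mult X (adj B) (adj A)"
  by (simp add: adj_def mult_def mult.commute)

lemma adj_adj [simp]: "adj (adj A) = A"
  by (simp add: adj_def)

lemma adj_id [simp]: "adj (id_op X) = id_op X"
  by (intro ext) (auto simp: adj_def id_op_def)

lemma apply_op_in_vecs [simp]: "apply_op X A \<phi> \<in> vecs X"
  by (simp add: apply_op_def vecs_def)

lemma apply_op_mult: "apply_op X (mult X A B) \<phi> = apply_op X A (apply_op X B \<phi>)"
proof (rule ext)
  fix f
  have "(\<Sum>g\<in>states X. mult X A B f g * \<phi> g) = (\<Sum>g\<in>states X. \<Sum>h\<in>states X. A f h * B h g * \<phi> g)"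
    by (simp add: mult_def sum_distrib_right)
  also have "\<dots> = (\<Sum>h\<in>states X. \<Sum>g\<in>states X. A f h * B h g * \<phi> g)"
    by (rule sum.swap)
  also have "\<dots> = (\<Sum>h\<in>states X. A f h * (\<Sum>g\<in>states X. B h g * \<phi> g))"
    by (simp add: sum_distrib_left mult.assoc)
  also have "\<dots> = (\<Sum>h\<in>states X. A f h * apply_op X B \<phi> h)"
    by (rule sum.cong) (auto simp: apply_op_def)
  finally show "apply_op X (mult X A B) \<phi> f = apply_op X A (apply_op X B \<phi>) f"
    by (simp add: apply_op_def)
qed

lemma apply_op_id: "finite X \<Longrightarrow> \<phi> \<in> vecs X \<Longrightarrow> apply_op X (id_op X) \<phi> = \<phi>"
  by (rule ext) (simp add: apply_op_def id_op_def vecs_def if_distrib[of "\<lambda>x. x * _"] cong: if_cong)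

lemma apply_op_add: "apply_op X A (\<lambda>f. u f + v f) = (\<lambda>f. apply_op X A u f + apply_op X A v f)"
  by (auto simp: apply_op_def distrib_left sum.distrib)

lemma apply_op_scale: "apply_op X A (\<lambda>f. c * u f) = (\<lambda>f. c * apply_op X A u f)"
  by (auto simp: apply_op_def sum_distrib_left mult.left_commute)

lemma mult_outer: "is_op X A \<Longrightarrow> mult X A (outer u v) = outer (apply_op X A u) v"
  by (auto simp: mult_def outer_def apply_op_def fun_eq_iff sum_distrib_right is_opD mult.assoc)

lemma apply_op_col: "is_op X A \<Longrightarrow> apply_op X A (\<lambda>h. B h g) = (\<lambda>f. mult X A B f g)"
  by (auto simp: apply_op_def mult_def fun_eq_iff is_opD)

lemma trace_outer: "trace X (outer u v) = (\<Sum>f\<in>states X. u f * cnj (v f))"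
  by (simp add: trace_def outer_def)

lemma mult_cnj_nonneg: "0 \<le> z * cnj (z :: complex)"
  by (simp add: less_eq_complex_def)

lemma trace_outer_nonneg: "0 \<le> trace X (outer u u)"
  unfolding trace_outer by (rule sum_nonneg) (rule mult_cnj_nonneg)

lemma trace_outer_eq_0:
  assumes "finite X" "u \<in> vecs X" "trace X (outer u u) = 0" shows "u = (\<lambda>_. 0)"
proof
  fix f
  have "\<forall>f\<in>states X. u f * cnj (u f) = 0"
    using assms unfolding trace_outer
    by (subst (asm) sum_nonneg_eq_0_iff) (auto simp: mult_cnj_nonneg)
  with assms show "u f = 0" by (auto simp: vecs_def)
qed

subsection \<open>Positive operators\<close>

text \<open>The bridge from functionals of operators to forms on vectors: evaluated at rank-one
  operators, \<open>tr (A \<rho>)\<close> becomes a sesquilinear form, so arguments about positive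
  forms apply to effects.\<close>

lemma sesq_eq_trace: "sesq X A u v = trace X (mult X A (outer v u))"
  by (simp add: sesq_def trace_def mult_def outer_def algebra_simps)

lemma sesq_add_right: "sesq X A u (\<lambda>f. v f + w f) = sesq X A u v + sesq X A u w"
  by (simp add: sesq_def algebra_simps sum.distrib)

lemma sesq_add_left: "sesq X A (\<lambda>f. v f + w f) u = sesq X A v u + sesq X A w u"
  by (simp add: sesq_def algebra_simps sum.distrib)

lemma sesq_scale_right: "sesq X A u (\<lambda>f. c * v f) = c * sesq X A u v"
  by (simp add: sesq_def sum_distrib_left algebra_simps)

lemma sesq_scale_left: "sesq X A (\<lambda>f. c * v f) u = cnj c * sesq X A v u"
  by (simp add: sesq_def sum_distrib_left algebra_simps)

lemma positive_iff: "positive X A \<longleftrightarrow> is_op X A \<and> (\<forall>\<psi>. 0 \<le> sesq X A \<psi> \<psi>)"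
  by (simp add: positive_def sesq_def)

lemma sesq_unit_left:
  "finite X \<Longrightarrow> f \<in> states X \<Longrightarrow> sesq X A (\<lambda>h. if h = f then 1 else 0) v = (\<Sum>g\<in>states X. A f g * v g)"
  unfolding sesq_def
  by (subst sum.swap) (auto simp: if_distrib[of cnj] if_distrib[of "\<lambda>x. x * _"] cong: if_cong)

lemma sesq_unit_right:
  "finite X \<Longrightarrow> g \<in> states X \<Longrightarrow> sesq X A u (\<lambda>h. if h = g then 1 else 0) = (\<Sum>f\<in>states X. cnj (u f) * A f g)"
  unfolding sesq_def
  by (auto simp: if_distrib[of "\<lambda>x. _ * x"] cong: if_cong)

text \<open>A real-affine function on the plane that is bounded below is constant. The values at
  \<open>0\<close>, \<open>1\<close> and \<open>\<i>\<close> force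
  \<open>\<beta> = cnj \<alpha>\<close>; then \<open>t\<close> is sent to infinity in the direction
  \<open>- cnj \<alpha>\<close>.\<close>

lemma affine_nonneg_imp_zero:
  fixes \<alpha> \<beta> c :: complex
  assumes "\<And>t. 0 \<le> t * \<alpha> + cnj t * \<beta> + c"
  shows "\<alpha> = 0 \<and> \<beta> = 0"
proof -
  have c: "Im c = 0" using assms[of 0] by (simp add: less_eq_complex_def)
  have 1: "Im \<alpha> + Im \<beta> = 0" using assms[of 1] c by (simp add: less_eq_complex_def)
  have 2: "Re \<alpha> = Re \<beta>" using assms[of \<i>] c by (simp add: less_eq_complex_def)
  have *: "\<beta> = cnj \<alpha>" using 1 2 by (simp add: complex_eq_iff)
  have r: "0 \<le> - 2 * n * (cmod \<alpha>)^2 + Re c" for n :: real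
  proof -
    have "- (of_real n * cnj \<alpha>) * \<alpha> + cnj (- (of_real n * cnj \<alpha>)) * \<beta> + c
        = of_real (- 2 * n * (cmod \<alpha>)^2) + c"
      using complex_norm_square[of \<alpha>] unfolding * by (simp add: algebra_simps)
    then show ?thesis using assms[of "- (of_real n * cnj \<alpha>)"]
      by (simp add: less_eq_complex_def)
  qed
  have "\<alpha> = 0"
  proof (rule ccontr)
    assume "\<alpha> \<noteq> 0"
    then have p: "(cmod \<alpha>)^2 > 0" by simp
    \<comment> \<open>This multiple is chosen so that the affine expression takes the value
      \<open>-1\<close>.\<close>
    have "0 \<le> - 2 * ((Re c + 1) / (2 * (cmod \<alpha>)^2)) * (cmod \<alpha>)^2 + Re c" by (rule r)
    also have "\<dots> = - 1" using p by (simp add: field_simps)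
    finally show False by simp
  qed
  with * show ?thesis by simp
qed

text \<open>Expanding the form at \<open>w + t v\<close>, the term in \<open>|t|^2\<close> drops out
  by hypothesis, and what remains is affine in \<open>t\<close> and nonnegative. This plays the role
  of the Cauchy-Schwarz inequality throughout.\<close>

lemma positive_sesq_null:
  assumes "positive X A" "sesq X A v v = 0"
  shows "sesq X A w v = 0 \<and> sesq X A v w = 0"
proof (rule affine_nonneg_imp_zero[where c = "sesq X A w w"])
  fix t
  have "0 \<le> sesq X A (\<lambda>f. w f + t * v f) (\<lambda>f. w f + t * v f)"
    using assms(1) by (simp add: positive_iff)
  then show "0 \<le> t * sesq X A w v + cnj t * sesq X A v w + sesq X A w w"
    by (simp only: sesq_add_left sesq_add_right sesq_scale_left sesq_scale_right assms(2))
       (simp add: algebra_simps)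
qed

lemma positive_outer: "u \<in> vecs X \<Longrightarrow> positive X (outer u u)"
proof -
  assume u: "u \<in> vecs X"
  have "0 \<le> sesq X (outer u u) \<psi> \<psi>" for \<psi>
  proof -
    define z where "z = (\<Sum>f\<in>states X. cnj (\<psi> f) * u f)"
    have "sesq X (outer u u) \<psi> \<psi> = z * cnj z"
      unfolding z_def cnj_sum sum_product sesq_def outer_def by (simp add: mult_ac)
    then show ?thesis by (simp add: mult_cnj_nonneg)
  qed
  with u show ?thesis by (simp add: positive_iff)
qed

lemma positive_scale:
  assumes "positive X A" "0 \<le> c" shows "positive X (\<lambda>f g. c * A f g)"
proof -
  have "sesq X (\<lambda>f g. c * A f g) \<psi> \<psi> = c * sesq X A \<psi> \<psi>" for \<psi>
    by (simp add: sesq_def sum_distrib_left algebra_simps)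
  with assms show ?thesis by (simp add: positive_iff is_op_scale)
qed

text \<open>The quadratic form of \<open>C A C\<^sup>\<dagger>\<close> at \<open>\<psi>\<close> is
  that of \<open>A\<close> at \<open>C\<^sup>\<dagger> \<psi>\<close>; in trace form this is a
  cyclic shift of \<open>C\<close>.\<close>

lemma positive_conj:
  assumes "positive X A" "is_op X C" shows "positive X (mult X C (mult X A (adj C)))"
proof -
  have "sesq X (mult X C (mult X A (adj C))) \<psi> \<psi> = sesq X A (apply_op X (adj C) \<psi>) (apply_op X (adj C) \<psi>)" for \<psi>
  proof -
    have "sesq X (mult X C (mult X A (adj C))) \<psi> \<psi> = trace X (mult X C (mult X (mult X A (adj C)) (outer \<psi> \<psi>)))"
      by (simp add: sesq_eq_trace mult_assoc)
    also have "\<dots> = trace X (mult X A (mult X (adj C) (mult X (outer \<psi> \<psi>) C)))"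
      by (subst trace_mult_commute) (simp add: mult_assoc)
    also have "mult X (outer \<psi> \<psi>) C = adj (mult X (adj C) (outer \<psi> \<psi>))"
      by (simp add: adj_mult) (simp add: adj_def outer_def mult.commute)
    also have "\<dots> = outer \<psi> (apply_op X (adj C) \<psi>)"
      using assms(2) by (simp add: mult_outer) (simp add: adj_def outer_def mult.commute)
    also have "mult X (adj C) \<dots> = outer (apply_op X (adj C) \<psi>) (apply_op X (adj C) \<psi>)"
      using assms(2) by (simp add: mult_outer)
    finally show ?thesis by (simp add: sesq_eq_trace)
  qed
  with assms show ?thesis by (simp add: positive_iff)
qed

lemma positive_trace_nonneg:
  assumes "finite X" "positive X A" shows "0 \<le> trace X A"
  unfolding trace_def
proof (rule sum_nonneg)
  fix f assume f: "f \<in> states X"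
  let ?e = "\<lambda>h. if h = f then 1 else 0 :: complex"
  have "sesq X A ?e ?e = A f f"
    using assms(1) f by (simp add: sesq_unit_left) (simp add: if_distrib[of "\<lambda>x. _ * x"] cong: if_cong)
  with assms(2) show "0 \<le> A f f" by (metis positive_iff)
qed

subsection \<open>Projectors\<close>

lemma is_projD: assumes "is_proj X P"
  shows "is_op X P" "mult X P P = P" "adj P = P" "cnj (P f g) = P g f"
proof -
  show *: "is_op X P" "mult X P P = P" "adj P = P" using assms by (auto simp: is_proj_def)
  show "cnj (P f g) = P g f" using fun_cong[OF fun_cong[OF *(3)], of g f] by (simp add: adj_def)
qed

lemma is_proj_compl: assumes "finite X" "is_proj X P" shows "is_proj X (compl_op X P)"
proof -
  note P = is_projD[OF assms(2)]
  have "adj (compl_op X P) = compl_op X P"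
    using P(4) fun_cong[OF fun_cong[OF adj_id[of X]]]
    by (intro ext) (simp add: adj_def compl_op_def)
  then show ?thesis
    using P assms(1) by (simp add: is_proj_def mult_compl_left mult_compl_right)
qed

lemma is_proj_zero: "is_proj X zero_op"
  by (simp add: is_proj_def) (simp add: mult_def adj_def zero_op_def)

lemma is_proj_id: "finite X \<Longrightarrow> is_proj X (id_op X)"
  by (simp add: is_proj_def mult_id_left)

lemma img_proj: "is_proj X P \<Longrightarrow> img X P = {\<phi> \<in> vecs X. apply_op X P \<phi> = \<phi>}"
proof -
  assume "is_proj X P"
  then have "apply_op X P (apply_op X P \<phi>) = apply_op X P \<phi>" for \<phi>
    by (simp flip: apply_op_mult add: is_projD)
  then show ?thesis by (auto simp: img_def) metis
qed

lemma img_imp_vecs: "\<phi> \<in> img X P \<Longrightarrow> \<phi> \<in> vecs X"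
  by (auto simp: img_def)

lemma proj_col_in_img: "is_proj X P \<Longrightarrow> (\<lambda>h. P h g) \<in> img X P"
  by (auto simp: img_proj apply_op_col is_projD vecs_def is_opD(1)[OF is_projD(1)])

text \<open>Left multiplication acts column by column. Conditions on output operators thereby become
  memberships of vectors in a subspace, the form in which meets, inclusions and spans can be
  handled.\<close>

lemma proj_fixes_iff:
  assumes "is_proj X P" "is_op X A"
  shows "mult X P A = A \<longleftrightarrow> (\<forall>g. (\<lambda>h. A h g) \<in> img X P)"
proof -
  have "(\<lambda>h. A h g) \<in> vecs X" for g using assms(2) by (auto simp: vecs_def is_opD)
  then show ?thesis using assms
    by (simp add: img_proj apply_op_col is_projD fun_eq_iff) blast
qed

lemma proj_le_iff:
  assumes "is_proj X P" "is_proj X Q"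
  shows "proj_le X P Q \<longleftrightarrow> mult X Q P = P"
proof
  assume "proj_le X P Q"
  then show "mult X Q P = P"
    using proj_col_in_img[OF assms(1)] assms by (auto simp: proj_fixes_iff is_projD proj_le_def)
next
  assume *: "mult X Q P = P"
  show "proj_le X P Q"
    unfolding proj_le_def
  proof
    fix \<phi> assume "\<phi> \<in> img X P"
    then have "\<phi> \<in> vecs X" "apply_op X P \<phi> = \<phi>" using assms by (auto simp: img_proj)
    moreover from this * have "apply_op X Q \<phi> = \<phi>" by (metis apply_op_mult)
    ultimately show "\<phi> \<in> img X Q" using assms by (simp add: img_proj)
  qed
qed

text \<open>Equal images give \<open>Q P = P\<close> and \<open>P Q = Q\<close>, and taking adjoints
  identifies the two products. The uniqueness half of every \<open>THE\<close> about projectors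
  rests on this.\<close>

lemma proj_eqI:
  assumes "is_proj X P" "is_proj X Q" "img X P = img X Q" shows "P = Q"
proof -
  have "mult X Q P = P" "mult X P Q = Q"
    using assms by (simp_all add: proj_le_def flip: proj_le_iff)
  moreover have "adj (mult X Q P) = mult X P Q"
    using assms by (simp add: adj_mult is_projD)
  ultimately show ?thesis using assms by (simp add: is_projD)
qed

text \<open>\<open>tr (P A) = tr (P A P)\<close> is a sum of values of the form of \<open>A\<close>
  at the columns of \<open>P\<close>. For positive \<open>A\<close> every summand is nonnegative, so
  a zero trace splits into zero summands.\<close>

lemma trace_proj_mult:
  assumes "is_proj X P"
  shows "trace X (mult X P A) = (\<Sum>f\<in>states X. sesq X A (\<lambda>h. P h f) (\<lambda>h. P h f))"
proof -
  have "trace X (mult X P A) = trace X (mult X P (mult X P A))"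
    using assms by (simp flip: mult_assoc add: is_projD)
  also have "\<dots> = trace X (mult X P (mult X A P))"
    by (subst trace_mult_commute) (simp add: mult_assoc)
  also have "\<dots> = (\<Sum>f\<in>states X. sesq X A (\<lambda>h. P h f) (\<lambda>h. P h f))"
    by (simp add: trace_def mult_def sesq_def is_projD[OF assms] sum_distrib_left mult.assoc)
  finally show ?thesis .
qed

lemma trace_proj_nonneg:
  assumes "is_proj X P" "positive X A" shows "0 \<le> trace X (mult X P A)"
  using assms by (simp add: trace_proj_mult positive_iff sum_nonneg)

lemma trace_compl_mult:
  "finite X \<Longrightarrow> is_op X A \<Longrightarrow> trace X (mult X (compl_op X P) A) = trace X A - trace X (mult X P A)"
  by (simp add: mult_compl_left trace_diff)

lemma trace_proj_le:
  assumes "finite X" "is_proj X P" "positive X A" shows "trace X (mult X P A) \<le> trace X A"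
  using trace_proj_nonneg[OF is_proj_compl[OF assms(1,2)] assms(3)] assms
  by (simp add: trace_compl_mult positive_iff)

text \<open>Every column of \<open>P\<close> is a null vector of the form of \<open>A\<close>, hence
  is annihilated by \<open>A\<close>; paired with unit vectors, this gives the entries of
  \<open>P A\<close>.\<close>

lemma trace_proj_eq_0:
  assumes "finite X" "is_proj X P" "positive X A" "trace X (mult X P A) = 0"
  shows "mult X P A = zero_op"
proof (rule op_eqI[of X])
  fix f g assume fg: "f \<in> states X" "g \<in> states X"
  have "\<forall>f\<in>states X. sesq X A (\<lambda>h. P h f) (\<lambda>h. P h f) = 0"
    using assms by (simp add: trace_proj_mult)
      (subst (asm) sum_nonneg_eq_0_iff, auto simp: positive_iff)
  with fg have "sesq X A (\<lambda>h. P h f) (\<lambda>h. if h = g then 1 else 0) = 0"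
    using assms(3) by (meson positive_sesq_null)
  then show "mult X P A f g = zero_op f g"
    using fg assms by (simp add: sesq_unit_right is_projD(4) mult_def zero_op_def)
qed (use assms in \<open>auto simp: is_projD positive_iff\<close>)

text \<open>No trace outside \<open>P\<close> means nothing outside \<open>P\<close>, by the
  vanishing result for the complement. It turns equalities of numbers into equalities of operators,
  off-diagonal entries included.\<close>

lemma trace_proj_eq_iff:
  assumes "finite X" "is_proj X P" "positive X A"
  shows "trace X (mult X P A) = trace X A \<longleftrightarrow> mult X P A = A"
proof
  assume "trace X (mult X P A) = trace X A"
  then have "trace X (mult X (compl_op X P) A) = 0"
    using assms by (simp add: trace_compl_mult positive_iff)
  then have "mult X (compl_op X P) A = zero_op"
    using assms by (simp add: trace_proj_eq_0 is_proj_compl)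
  then show "mult X P A = A" using assms
    by (simp add: mult_compl_left positive_iff zero_op_def fun_eq_iff)
qed simp

subsection \<open>Subspaces and their projectors\<close>

definition subsp :: "vec set \<Rightarrow> bool" where
  "subsp N \<longleftrightarrow> (\<lambda>_. 0) \<in> N \<and> (\<forall>u\<in>N. \<forall>v\<in>N. (\<lambda>f. u f + v f) \<in> N) \<and> (\<forall>c. \<forall>u\<in>N. (\<lambda>f. c * u f) \<in> N)"

lemma subspD:
  assumes "subsp N"
  shows "(\<lambda>_. 0) \<in> N" "u \<in> N \<Longrightarrow> v \<in> N \<Longrightarrow> (\<lambda>f. u f + v f) \<in> N" "u \<in> N \<Longrightarrow> (\<lambda>f. c * u f) \<in> N"
  using assms by (auto simp: subsp_def)

lemma subsp_sum:
  "finite T \<Longrightarrow> subsp N \<Longrightarrow> (\<And>t. t \<in> T \<Longrightarrow> w t \<in> N) \<Longrightarrow> (\<lambda>f. \<Sum>t\<in>T. w t f) \<in> N"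
  by (induction T rule: finite_induct) (simp_all add: subspD)

lemma vspan_least:
  assumes "subsp N" "S \<subseteq> N" shows "vspan S \<subseteq> N"
proof
  fix u assume "u \<in> vspan S"
  then obtain T c where T: "finite T" "T \<subseteq> S" "u = (\<lambda>f. \<Sum>t\<in>T. c t * t f)"
    unfolding vspan_def by blast
  have "(\<lambda>f. \<Sum>t\<in>T. c t * t f) \<in> N"
    by (rule subsp_sum[OF T(1) assms(1)], rule subspD(3)[OF assms(1)]) (use T assms in blast)
  with T show "u \<in> N" by simp
qed

lemma vspan_superset: "S \<subseteq> vspan S"
proof
  fix u assume "u \<in> S"
  then show "u \<in> vspan S"
    unfolding vspan_def by (intro CollectI exI[of _ "{u}"] exI[of _ "\<lambda>_. 1"]) auto
qed

lemma subsp_vspan: "subsp (vspan S)"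
proof -
  have "(\<lambda>_. 0) \<in> vspan S"
    unfolding vspan_def by (rule CollectI, rule exI[of _ "{}"]) auto
  moreover have "(\<lambda>f. u f + v f) \<in> vspan S" if "u \<in> vspan S" "v \<in> vspan S" for u v
  proof -
    from that obtain T c T' c' where *: "finite T" "T \<subseteq> S" "finite T'" "T' \<subseteq> S"
      "u = (\<lambda>f. \<Sum>t\<in>T. c t * t f)" "v = (\<lambda>f. \<Sum>t\<in>T'. c' t * t f)"
      unfolding vspan_def by blast
    \<comment> \<open>The two combinations run over different finite sets; padding the coefficients
      with zeros puts both on \<open>T \<union> T'\<close>.\<close>
    define d where "d t = (if t \<in> T then c t else 0) + (if t \<in> T' then c' t else 0)" for t
    have "u = (\<lambda>f. \<Sum>t\<in>T \<union> T'. (if t \<in> T then c t else 0) * t f)"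
      "v = (\<lambda>f. \<Sum>t\<in>T \<union> T'. (if t \<in> T' then c' t else 0) * t f)"
      unfolding * using *(1,3)
      by (auto simp: fun_eq_iff intro!: sum.mono_neutral_cong_left)
    then have "(\<lambda>f. u f + v f) = (\<lambda>f. \<Sum>t\<in>T \<union> T'. d t * t f)"
      by (simp add: d_def distrib_right sum.distrib)
    then show ?thesis
      using * unfolding vspan_def by (intro CollectI exI[of _ "T \<union> T'"] exI[of _ d]) auto
  qed
  moreover have "(\<lambda>f. k * u f) \<in> vspan S" if "u \<in> vspan S" for u k
  proof -
    from that obtain T c where *: "finite T" "T \<subseteq> S" "u = (\<lambda>f. \<Sum>t\<in>T. c t * t f)"
      unfolding vspan_def by blast
    then show ?thesis unfolding vspan_def
      by (intro CollectI exI[of _ T] exI[of _ "\<lambda>t. k * c t"]) (auto simp: sum_distrib_left mult.assoc)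
  qed
  ultimately show ?thesis by (simp add: subsp_def)
qed

lemma subsp_vecs: "subsp (vecs X)"
  by (simp add: subsp_def vecs_def)

lemma subsp_img: "subsp (img X A)"
proof -
  have "(\<lambda>_. 0) = apply_op X A (\<lambda>_. 0)" by (rule ext) (simp add: apply_op_def)
  then show ?thesis
    unfolding subsp_def img_def
    using apply_op_add[of X A, symmetric] apply_op_scale[of X A, symmetric] by blast
qed

lemma subsp_Int: "subsp M \<Longrightarrow> subsp N \<Longrightarrow> subsp (M \<inter> N)"
  by (auto simp: subsp_def)

lemma positive_id: assumes "finite X" shows "positive X (id_op X)"
proof -
  have "sesq X (id_op X) \<psi> \<psi> = trace X (outer \<psi> \<psi>)" for \<psi>
    using assms by (simp add: sesq_def id_op_def trace_outer if_distrib[of "\<lambda>x. _ * x"]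
        if_distrib[of "\<lambda>x. x * _"] mult.commute cong: if_cong)
  then show ?thesis by (simp add: positive_iff trace_outer_nonneg)
qed

lemma trace_id: "trace X (id_op X) = of_nat (card (states X))"
  by (simp add: trace_def id_op_def)

lemma apply_zero_op [simp]: "apply_op X zero_op \<phi> = (\<lambda>_. 0)"
  by (rule ext) (simp add: apply_op_def zero_op_def)

text \<open>One Gram-Schmidt step: the component \<open>w\<close> of \<open>v\<close> orthogonal to
  the image is nonzero, and the rank-one projector \<open>K\<close> along \<open>w\<close> is added.
  As \<open>P K = K P = 0\<close>, the sum is again a projector, and \<open>K\<close> contributes
  trace one.\<close>

lemma proj_extend:
  assumes X: "finite X" and P: "is_proj X P" and N: "subsp N" "N \<subseteq> vecs X"
    and PN: "img X P \<subseteq> N" and v: "v \<in> N" "v \<notin> img X P"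
  shows "\<exists>P'. is_proj X P' \<and> img X P' \<subseteq> N \<and> trace X P' = trace X P + 1"
proof -
  define w where "w = (\<lambda>f. v f + (-1) * apply_op X P v f)"
  have wN: "w \<in> N"
    unfolding w_def by (intro subspD N v) (use PN in \<open>auto simp: img_def\<close>)
  then have wX: "w \<in> vecs X" using N by auto
  have Pw: "apply_op X P w = (\<lambda>_. 0)"
    unfolding w_def apply_op_add apply_op_scale
    by (simp flip: apply_op_mult add: is_projD[OF P])
  have "w \<noteq> (\<lambda>_. 0)"
  proof
    assume "w = (\<lambda>_. 0)"
    then have "apply_op X P v f = v f" for f by (simp add: w_def fun_eq_iff)
    then have "apply_op X P v = v" ..
    with v P N show False by (auto simp: img_proj)
  qed
  define n where "n = trace X (outer w w)"
  have n: "n \<noteq> 0" using \<open>w \<noteq> _\<close> trace_outer_eq_0[OF X wX] unfolding n_def by argo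
  have cn: "cnj n = n" unfolding n_def trace_outer by (simp add: mult.commute)
  define K where "K = (\<lambda>f g. (1/n) * outer w w f g)"
  have K: "is_op X K" "adj K = K"
    unfolding K_def using wX
    by (intro is_op_scale is_op_outer) (simp_all add: adj_def outer_def cn mult.commute)
  have PO: "mult X P K = zero_op"
    unfolding K_def mult_scale_right using Pw by (simp add: mult_outer is_projD[OF P])
      (simp add: outer_def zero_op_def)
  have OP: "mult X K P = zero_op"
  proof -
    have "mult X K P = adj (mult X P K)" by (simp add: adj_mult K is_projD[OF P])
    then show ?thesis by (simp add: PO) (simp add: adj_def zero_op_def)
  qed
  have oo: "mult X (outer w w) (outer w w) = (\<lambda>f g. n * outer w w f g)"
    unfolding n_def trace_outer sum_distrib_right mult_def by (simp add: outer_def mult_ac)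
  have OO: "mult X K K = K"
  proof -
    have "mult X K (outer w w) = (\<lambda>f g. (1/n) * mult X (outer w w) (outer w w) f g)"
      by (simp add: K_def mult_def sum_distrib_left mult.assoc)
    then show ?thesis
      unfolding K_def mult_scale_right by (simp add: K_def oo n)
  qed
  define P' where "P' = (\<lambda>f g. P f g + K f g)"
  have "mult X P' P' = (\<lambda>f g. mult X P P f g + mult X P K f g + mult X K P f g + mult X K K f g)"
    by (simp add: P'_def mult_def algebra_simps sum.distrib)
  then have "mult X P' P' = P'"
    by (simp add: PO OP OO is_projD[OF P]) (simp add: P'_def zero_op_def)
  moreover have "adj P' = P'"
    using K is_projD(3)[OF P] by (simp add: P'_def adj_def fun_eq_iff)
  moreover have "is_op X P'"
    unfolding P'_def by (intro is_op_add K is_projD[OF P])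
  moreover have "img X P' \<subseteq> N"
  proof -
    have "apply_op X P' \<phi> \<in> N" for \<phi>
    proof -
      have "apply_op X P' \<phi> = (\<lambda>f. apply_op X P \<phi> f + ((1/n) * (\<Sum>g\<in>states X. cnj (w g) * \<phi> g)) * w f)"
        using wX by (auto simp: fun_eq_iff apply_op_def P'_def K_def outer_def vecs_def
            algebra_simps sum.distrib sum_distrib_left sum_distrib_right)
      also have "\<dots> \<in> N" by (intro subspD N wN) (use PN in \<open>auto simp: img_def\<close>)
      finally show ?thesis .
    qed
    then show ?thesis by (auto simp: img_def)
  qed
  moreover have "trace X P' = trace X P + 1"
    using n unfolding P'_def K_def trace_add trace_scale by (simp add: n_def)
  ultimately show ?thesis unfolding is_proj_def by blast
qed

text \<open>Projectors into the subspace can be enlarged until they exhaust it, since each enlargement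
  raises the trace by one and the trace is bounded by the dimension.\<close>
lemma exists_proj:
  assumes X: "finite X" and N: "subsp N" "N \<subseteq> vecs X"
  shows "\<exists>P. is_proj X P \<and> img X P = N"
proof (rule ccontr)
  assume no: "\<not> ?thesis"
  have "\<exists>P. is_proj X P \<and> img X P \<subseteq> N \<and> trace X P = of_nat n" for n
  proof (induction n)
    case 0
    have "img X zero_op \<subseteq> N" using subspD(1)[OF N(1)]
      by (auto simp: img_def)
    moreover have "trace X zero_op = 0" by (simp add: trace_def zero_op_def)
    ultimately show ?case using is_proj_zero by (metis of_nat_0)
  next
    case (Suc n)
    then obtain P where P: "is_proj X P" "img X P \<subseteq> N" "trace X P = of_nat n" by blast
    with no obtain v where "v \<in> N" "v \<notin> img X P" by blast
    from proj_extend[OF X P(1) N P(2) this] show ?case by (simp add: P(3) add.commute)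
  qed
  from this[of "Suc (card (states X))"]
  obtain P where P: "is_proj X P" "trace X P = of_nat (Suc (card (states X)))" by blast
  have "trace X (mult X P (id_op X)) \<le> trace X (id_op X)"
    by (intro trace_proj_le X P positive_id)
  then show False
    using X P by (simp add: mult_id_right is_projD trace_id) (simp add: less_eq_complex_def)
qed

lemma proj_of_eq: "is_proj X P \<Longrightarrow> img X P = N \<Longrightarrow> proj_of X N = P"
  unfolding proj_of_def by (rule the_equality) (auto intro: proj_eqI)

lemma proj_of_props:
  assumes "finite X" "subsp N" "N \<subseteq> vecs X"
  shows "is_proj X (proj_of X N)" "img X (proj_of X N) = N"
proof -
  obtain P where "is_proj X P" "img X P = N" using exists_proj[OF assms] by blast
  then show "is_proj X (proj_of X N)" "img X (proj_of X N) = N" by (simp_all add: proj_of_eq)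
qed

lemma proj_meet_props:
  assumes "finite X"
  shows "is_proj X (proj_meet X P Q)" "img X (proj_meet X P Q) = img X P \<inter> img X Q"
proof -
  have "subsp (img X P \<inter> img X Q)" "img X P \<inter> img X Q \<subseteq> vecs X"
    by (auto intro: subsp_Int subsp_img img_imp_vecs)
  from proj_of_props[OF assms this]
  show "is_proj X (proj_meet X P Q)" "img X (proj_meet X P Q) = img X P \<inter> img X Q"
    by (simp_all add: proj_meet_def)
qed

lemma proj_join_props:
  assumes "finite X"
  shows "is_proj X (proj_join X P Q)" "img X (proj_join X P Q) = vspan (img X P \<union> img X Q)"
proof -
  have "vspan (img X P \<union> img X Q) \<subseteq> vecs X"
    by (intro vspan_least subsp_vecs) (auto intro: img_imp_vecs)
  from proj_of_props[OF assms subsp_vspan this]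
  show "is_proj X (proj_join X P Q)" "img X (proj_join X P Q) = vspan (img X P \<union> img X Q)"
    by (simp_all add: proj_join_def)
qed

subsection \<open>Linear functionals on operators\<close>

text \<open>Linearity is asked only for operators on the register, since that is all that
  \<open>DProg\<close> guarantees for a program.\<close>

definition lin_on :: "nat set \<Rightarrow> (op \<Rightarrow> complex) \<Rightarrow> bool" where
  "lin_on X \<delta> \<longleftrightarrow>
     (\<forall>A B. is_op X A \<longrightarrow> is_op X B \<longrightarrow> \<delta> (\<lambda>f g. A f g + B f g) = \<delta> A + \<delta> B) \<and>
     (\<forall>c A. is_op X A \<longrightarrow> \<delta> (\<lambda>f g. c * A f g) = c * \<delta> A)"

lemma lin_on_sum:
  assumes "lin_on X \<delta>" "finite I" "\<And>i. i \<in> I \<Longrightarrow> is_op X (A i)"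
  shows "\<delta> (\<lambda>f g. \<Sum>i\<in>I. A i f g) = (\<Sum>i\<in>I. \<delta> (A i))"
  using assms(2,3)
proof (induction I rule: finite_induct)
  case empty
  have "\<delta> (\<lambda>f g. 0 * zero_op f g) = 0 * \<delta> zero_op"
    using assms(1) is_op_zero unfolding lin_on_def by blast
  then show ?case by (simp add: zero_op_def)
next
  case (insert i I)
  then have "is_op X (A i)" "is_op X (\<lambda>f g. \<Sum>i\<in>I. A i f g)" by (auto intro: is_op_sum)
  with assms(1) have "\<delta> (\<lambda>f g. A i f g + (\<Sum>i\<in>I. A i f g)) = \<delta> (A i) + \<delta> (\<lambda>f g. \<Sum>i\<in>I. A i f g)"
    unfolding lin_on_def by blast
  with insert show ?case by simp
qed

lemma lin_on_diff: "lin_on X \<delta> \<Longrightarrow> lin_on X \<epsilon> \<Longrightarrow> lin_on X (\<lambda>\<rho>. \<delta> \<rho> - \<epsilon> \<rho>)"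
  by (simp add: lin_on_def algebra_simps)

text \<open>Expansion in matrix units. Applied to \<open>\<rho> \<mapsto> tr (Q (E \<rho>))\<close>,
  it supplies a matrix that acts as the dual of \<open>E\<close> at \<open>Q\<close>.\<close>

lemma lin_on_repr:
  assumes X: "finite X" and \<delta>: "lin_on X \<delta>"
  shows "\<exists>D. is_op X D \<and> (\<forall>\<rho>. is_op X \<rho> \<longrightarrow> \<delta> \<rho> = trace X (mult X D \<rho>))"
proof -
  define U :: "basis \<times> basis \<Rightarrow> op"
    where "U p = (\<lambda>f g. if f = fst p then if g = snd p then 1 else 0 else 0)" for p
  define S where "S = states X \<times> states X"
  have S: "finite S" using X by (simp add: S_def)
  have U: "is_op X (U p)" if "p \<in> S" for p
    using that by (auto simp: S_def U_def is_op_def)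
  \<comment> \<open>The indices are exchanged because the trace of \<open>D \<rho>\<close> pairs
    \<open>D f g\<close> with \<open>\<rho> g f\<close>.\<close>
  define D where "D = (\<lambda>f g. if f \<in> states X \<and> g \<in> states X then \<delta> (U (g, f)) else 0)"
  have "\<delta> \<rho> = trace X (mult X D \<rho>)" if \<rho>: "is_op X \<rho>" for \<rho>
  proof -
    have "(\<lambda>f g. \<Sum>p\<in>S. \<rho> (fst p) (snd p) * U p f g) = \<rho>"
    proof (rule op_eqI[of X])
      show "is_op X (\<lambda>f g. \<Sum>p\<in>S. \<rho> (fst p) (snd p) * U p f g)"
        by (intro is_op_sum is_op_scale U)
      fix f g assume fg: "f \<in> states X" "g \<in> states X"
      have "(\<Sum>p\<in>S. \<rho> (fst p) (snd p) * U p f g)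
        = (\<Sum>p\<in>S. if p = (f, g) then \<rho> f g else 0)"
        by (rule sum.cong) (auto simp: U_def)
      also have "\<dots> = \<rho> f g" using S fg by (simp add: S_def)
      finally show "(\<Sum>p\<in>S. \<rho> (fst p) (snd p) * U p f g) = \<rho> f g" .
    qed (fact \<rho>)
    then have "\<delta> \<rho> = \<delta> (\<lambda>f g. \<Sum>p\<in>S. \<rho> (fst p) (snd p) * U p f g)" by simp
    also have "\<dots> = (\<Sum>p\<in>S. \<delta> (\<lambda>f g. \<rho> (fst p) (snd p) * U p f g))"
      by (rule lin_on_sum[OF \<delta> S]) (intro is_op_scale U)
    also have "\<dots> = (\<Sum>p\<in>S. \<rho> (fst p) (snd p) * \<delta> (U p))"
      using \<delta> U by (intro sum.cong) (auto simp: lin_on_def)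
    also have "\<dots> = (\<Sum>g\<in>states X. \<Sum>f\<in>states X. \<rho> g f * \<delta> (U (g, f)))"
      by (simp add: S_def sum.cartesian_product case_prod_beta)
    also have "\<dots> = (\<Sum>f\<in>states X. \<Sum>g\<in>states X. \<rho> g f * \<delta> (U (g, f)))"
      by (rule sum.swap)
    also have "\<dots> = trace X (mult X D \<rho>)"
      by (simp add: trace_def mult_def D_def mult.commute)
    finally show ?thesis .
  qed
  moreover have "is_op X D" by (auto simp: D_def is_op_def)
  ultimately show ?thesis by blast
qed

text \<open>The functional form of \<open>0 \<le> D \<le> I\<close>, read through
  \<open>\<rho> \<mapsto> tr (D \<rho>)\<close>.\<close>

definition effect :: "nat set \<Rightarrow> (op \<Rightarrow> complex) \<Rightarrow> bool" where
  "effect X \<delta> \<longleftrightarrow> lin_on X \<delta> \<and> (\<forall>\<rho>. positive X \<rho> \<longrightarrow> 0 \<le> \<delta> \<rho> \<and> \<delta> \<rho> \<le> trace X \<rho>)"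

text \<open>For an effect this is the kernel of the representing operator \<open>D\<close>: by
  positivity, a vanishing quadratic form at \<open>\<psi>\<close> already means
  \<open>D \<psi> = 0\<close>.\<close>

definition null_space :: "nat set \<Rightarrow> (op \<Rightarrow> complex) \<Rightarrow> vec set" where
  "null_space X \<delta> = {\<psi> \<in> vecs X. \<delta> (outer \<psi> \<psi>) = 0}"

lemma effect_repr:
  assumes X: "finite X" and \<delta>: "effect X \<delta>"
  obtains D where "positive X D" "\<And>\<rho>. is_op X \<rho> \<Longrightarrow> \<delta> \<rho> = trace X (mult X D \<rho>)"
    "\<And>u v. u \<in> vecs X \<Longrightarrow> v \<in> vecs X \<Longrightarrow> \<delta> (outer u v) = sesq X D v u"
proof -
  have "lin_on X \<delta>" using \<delta> by (simp add: effect_def)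
  from lin_on_repr[OF X this] obtain D
    where D: "is_op X D" "\<And>\<rho>. is_op X \<rho> \<Longrightarrow> \<delta> \<rho> = trace X (mult X D \<rho>)"
    by blast
  have s: "\<delta> (outer u v) = sesq X D v u" if "u \<in> vecs X" "v \<in> vecs X" for u v
    using that by (simp add: D(2) sesq_eq_trace)
  have "0 \<le> sesq X D \<psi> \<psi>" for \<psi>
  proof -
    \<comment> \<open>\<open>positive\<close> quantifies over arbitrary functions, whereas the
      functional is controlled only on operators of the register; values outside
      \<open>states X\<close> are cut off.\<close>
    define \<phi> where "\<phi> f = (if f \<in> states X then \<psi> f else 0)" for f
    have \<phi>: "\<phi> \<in> vecs X" by (simp add: \<phi>_def vecs_def)
    have "sesq X D \<psi> \<psi> = sesq X D \<phi> \<phi>" by (simp add: sesq_def \<phi>_def)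
    also have "\<dots> = \<delta> (outer \<phi> \<phi>)" by (simp add: s \<phi>)
    also have "\<dots> \<ge> 0" using \<delta> positive_outer[OF \<phi>] by (simp add: effect_def)
    finally show ?thesis .
  qed
  with D(1) have "positive X D" by (simp add: positive_iff)
  with D(2) s show ?thesis using that by blast
qed

text \<open>Closure under addition is the point: the cross terms of the form vanish together with
  its diagonal values, by positivity.\<close>

lemma subsp_null_space:
  assumes X: "finite X" and \<delta>: "effect X \<delta>"
  shows "subsp (null_space X \<delta>)"
proof -
  obtain D where D: "positive X D"
    and s: "\<And>u v. u \<in> vecs X \<Longrightarrow> v \<in> vecs X \<Longrightarrow> \<delta> (outer u v) = sesq X D v u"
    using effect_repr[OF X \<delta>] by metis
  have N: "null_space X \<delta> = {\<psi> \<in> vecs X. sesq X D \<psi> \<psi> = 0}"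
    by (auto simp: null_space_def s)
  show ?thesis unfolding N subsp_def
  proof (intro conjI ballI allI)
    show "(\<lambda>_. 0) \<in> {\<psi> \<in> vecs X. sesq X D \<psi> \<psi> = 0}" by (simp add: vecs_def sesq_def)
  next
    fix u v assume "u \<in> {\<psi> \<in> vecs X. sesq X D \<psi> \<psi> = 0}" "v \<in> {\<psi> \<in> vecs X. sesq X D \<psi> \<psi> = 0}"
    then show "(\<lambda>f. u f + v f) \<in> {\<psi> \<in> vecs X. sesq X D \<psi> \<psi> = 0}"
      using positive_sesq_null[OF D, of u v] 
      by (simp add: subspD[OF subsp_vecs] sesq_add_left sesq_add_right)
  next
    fix c u assume "u \<in> {\<psi> \<in> vecs X. sesq X D \<psi> \<psi> = 0}"
    then show "(\<lambda>f. c * u f) \<in> {\<psi> \<in> vecs X. sesq X D \<psi> \<psi> = 0}"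
      by (simp add: subspD[OF subsp_vecs] sesq_scale_left sesq_scale_right)
  qed
qed

text \<open>If the effect \<open>D\<close> vanishes on the image of \<open>P\<close>, then \<open>D = P\<^sup>\<bottom> D P\<^sup>\<bottom>\<close>, and so
  \<open>tr (D \<rho>) = tr (D P\<^sup>\<bottom> \<rho> P\<^sup>\<bottom>) \<le> tr (P\<^sup>\<bottom> \<rho>)\<close>.\<close>
lemma effect_le_compl_iff:
  assumes X: "finite X" and \<delta>: "effect X \<delta>" and P: "is_proj X P"
  shows "(\<forall>\<rho>. positive X \<rho> \<longrightarrow> trace X (mult X P \<rho>) \<le> trace X \<rho> - \<delta> \<rho>) \<longleftrightarrow> img X P \<subseteq> null_space X \<delta>"
proof
  assume *: "\<forall>\<rho>. positive X \<rho> \<longrightarrow> trace X (mult X P \<rho>) \<le> trace X \<rho> - \<delta> \<rho>"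
  show "img X P \<subseteq> null_space X \<delta>"
  proof
    fix \<psi> assume "\<psi> \<in> img X P"
    then have \<psi>: "\<psi> \<in> vecs X" "apply_op X P \<psi> = \<psi>" using P by (auto simp: img_proj)
    \<comment> \<open>Necessity is tested on the pure state of \<open>\<psi>\<close>, which
      \<open>P\<close> fixes, so that only the effect is left in the inequality.\<close>
    have p: "positive X (outer \<psi> \<psi>)" using \<psi> by (simp add: positive_outer)
    have "mult X P (outer \<psi> \<psi>) = outer \<psi> \<psi>" using \<psi> P by (simp add: mult_outer is_projD)
    with * p have "trace X (outer \<psi> \<psi>) \<le> trace X (outer \<psi> \<psi>) - \<delta> (outer \<psi> \<psi>)" by fastforce
    then have "\<delta> (outer \<psi> \<psi>) \<le> 0" by (simp add: less_eq_complex_def)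
    moreover have "0 \<le> \<delta> (outer \<psi> \<psi>)" using \<delta> p by (simp add: effect_def)
    ultimately have "\<delta> (outer \<psi> \<psi>) = 0" by (rule antisym)
    with \<psi> show "\<psi> \<in> null_space X \<delta>" by (simp add: null_space_def)
  qed
next
  assume *: "img X P \<subseteq> null_space X \<delta>"
  obtain D where D: "positive X D" "\<And>\<rho>. is_op X \<rho> \<Longrightarrow> \<delta> \<rho> = trace X (mult X D \<rho>)"
    and s: "\<And>u v. u \<in> vecs X \<Longrightarrow> v \<in> vecs X \<Longrightarrow> \<delta> (outer u v) = sesq X D v u"
    using effect_repr[OF X \<delta>] by metis
  have opD: "is_op X D" using D(1) by (simp add: positive_iff)
  note P' = is_projD[OF P]
  have null: "sesq X D w (\<lambda>h. P h f) = 0" "sesq X D (\<lambda>h. P h f) w = 0" for f w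
  proof -
    have "(\<lambda>h. P h f) \<in> null_space X \<delta>" using * proj_col_in_img[OF P] by blast
    then have "sesq X D (\<lambda>h. P h f) (\<lambda>h. P h f) = 0" unfolding null_space_def by (simp flip: s)
    from positive_sesq_null[OF D(1) this]
    show "sesq X D w (\<lambda>h. P h f) = 0" "sesq X D (\<lambda>h. P h f) w = 0" by auto
  qed
  have DP: "mult X D P = zero_op"
  proof (rule op_eqI[of X])
    fix f g assume "f \<in> states X" "g \<in> states X"
    with null(1)[of "\<lambda>h. if h = f then 1 else 0" g] X
    show "mult X D P f g = zero_op f g" by (simp add: sesq_unit_left mult_def zero_op_def)
  qed (use opD P' in auto)
  have PD: "mult X P D = zero_op"
  proof (rule op_eqI[of X])
    fix f g assume "f \<in> states X" "g \<in> states X"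
    with null(2)[of f "\<lambda>h. if h = g then 1 else 0"] X
    show "mult X P D f g = zero_op f g" by (simp add: sesq_unit_right mult_def zero_op_def P'(4))
  qed (use opD P' in auto)
  let ?C = "compl_op X P"
  have C: "is_proj X ?C" by (rule is_proj_compl[OF X P])
  note C' = is_projD[OF C]
  have DC: "mult X D ?C = D" "mult X ?C D = D"
    using X opD by (simp_all add: mult_compl_left mult_compl_right DP PD zero_op_def)
  show "\<forall>\<rho>. positive X \<rho> \<longrightarrow> trace X (mult X P \<rho>) \<le> trace X \<rho> - \<delta> \<rho>"
  proof (intro allI impI)
    fix \<rho> assume \<rho>: "positive X \<rho>"
    then have op\<rho>: "is_op X \<rho>" by (simp add: positive_iff)
    have pos: "positive X (mult X ?C (mult X \<rho> ?C))"
      using positive_conj[OF \<rho> C'(1)] by (simp add: C')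
    have "\<delta> \<rho> = trace X (mult X (mult X ?C (mult X D ?C)) \<rho>)"
      by (simp add: D(2) op\<rho> DC)
    also have "\<dots> = trace X (mult X D (mult X ?C (mult X \<rho> ?C)))"
      by (simp add: mult_assoc) (subst trace_mult_commute, simp add: mult_assoc)
    also have "\<dots> = \<delta> (mult X ?C (mult X \<rho> ?C))"
      by (simp add: D(2) op\<rho> C')
    also have "\<dots> \<le> trace X (mult X ?C (mult X \<rho> ?C))"
      using \<delta> pos by (simp add: effect_def)
    also have "\<dots> = trace X (mult X ?C \<rho>)"
      by (subst trace_mult_commute) (simp add: mult_assoc C', subst trace_mult_commute, simp)
    also have "\<dots> = trace X \<rho> - trace X (mult X P \<rho>)"
      by (rule trace_compl_mult[OF X op\<rho>])
    finally show "trace X (mult X P \<rho>) \<le> trace X \<rho> - \<delta> \<rho>" by (simp add: algebra_simps)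
  qed
qed

subsection \<open>Splitting a register\<close>

lemma restr_in [simp]: "restr X f \<in> states X"
  by (simp add: restr_def states_def)

lemma restr_id [simp]: "f \<in> states X \<Longrightarrow> restr X f = f"
  by (auto simp: restr_def states_def)

lemma restr_restr: "restr A (restr B f) = restr (A \<inter> B) f"
  by (auto simp: restr_def)

lemma restr_eq_iff: "restr A f = restr A g \<longleftrightarrow> (\<forall>i\<in>A. f i = g i)"
  by (auto simp: restr_def fun_eq_iff)

lemma restr_merge1 [simp]: "u \<in> states X \<Longrightarrow> restr X (merge X u v) = u"
  by (auto simp: restr_def states_def merge_def)

lemma restr_merge2: "X \<inter> Y = {} \<Longrightarrow> v \<in> states Y \<Longrightarrow> restr Y (merge X u v) = v"
  by (force simp: restr_def states_def merge_def)

lemma merge_restr: "f \<in> states (X \<union> Y) \<Longrightarrow> merge X (restr X f) (restr Y f) = f"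
  by (force simp: restr_def states_def merge_def)

lemma merge_in: "u \<in> states X \<Longrightarrow> v \<in> states Y \<Longrightarrow> merge X u v \<in> states (X \<union> Y)"
  by (auto simp: states_def merge_def)

lemma restr_merge_Diff [simp]: "a \<in> states (X - Y) \<Longrightarrow> restr (X - Y) (merge Y u a) = a"
  by (rule restr_merge2) auto

lemma merge_in_Diff: "Y \<subseteq> X \<Longrightarrow> u \<in> states Y \<Longrightarrow> a \<in> states (X - Y) \<Longrightarrow> merge Y u a \<in> states X"
  using merge_in[of u Y a "X - Y"] by (simp add: Un_absorb1)

lemma merge_restr_Diff: "Y \<subseteq> X \<Longrightarrow> f \<in> states X \<Longrightarrow> merge Y (restr Y f) (restr (X - Y) f) = f"
  by (rule merge_restr) (simp add: Un_absorb1)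

lemma sum_states_Un:
  assumes "X \<inter> Y = {}"
  shows "(\<Sum>h\<in>states (X \<union> Y). \<phi> h) = (\<Sum>u\<in>states X. \<Sum>v\<in>states Y. \<phi> (merge X u v))"
  unfolding sum.cartesian_product
  by (rule sum.reindex_bij_witness[where j = "\<lambda>h. (restr X h, restr Y h)" and i = "\<lambda>(u, v). merge X u v"])
     (use assms in \<open>auto simp: merge_restr merge_in restr_merge2\<close>)

lemma sum_states_Diff:
  assumes "Y \<subseteq> X"
  shows "(\<Sum>h\<in>states X. \<phi> h) = (\<Sum>u\<in>states Y. \<Sum>a\<in>states (X - Y). \<phi> (merge Y u a))"
  using sum_states_Un[of Y "X - Y" \<phi>] assms by (simp add: Un_absorb1)

subsection \<open>Tensor products\<close>

lemma is_op_tensor [simp]: "is_op (X \<union> Y) (tensor X Y A B)"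
  by (auto simp: is_op_def tensor_def)

lemma tensor_mult:
  assumes "X \<inter> Y = {}"
  shows "mult (X \<union> Y) (tensor X Y A B) (tensor X Y C D) = tensor X Y (mult X A C) (mult Y B D)"
proof (rule op_eqI[of "X \<union> Y"])
  fix f g assume fg: "f \<in> states (X \<union> Y)" "g \<in> states (X \<union> Y)"
  have "mult (X \<union> Y) (tensor X Y A B) (tensor X Y C D) f g =
      (\<Sum>u\<in>states X. \<Sum>v\<in>states Y. (A (restr X f) u * B (restr Y f) v) * (C u (restr X g) * D v (restr Y g)))"
    unfolding mult_def sum_states_Un[OF assms]
    by (intro sum.cong refl) (use assms fg in \<open>simp add: tensor_def merge_in restr_merge2\<close>)
  also have "\<dots> = tensor X Y (mult X A C) (mult Y B D) f g"
    using fg by (simp add: tensor_def mult_def sum_product mult_ac)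
  finally show "mult (X \<union> Y) (tensor X Y A B) (tensor X Y C D) f g =
    tensor X Y (mult X A C) (mult Y B D) f g" .
qed auto

lemma adj_tensor: "adj (tensor X Y A B) = tensor X Y (adj A) (adj B)"
  by (intro ext) (auto simp: adj_def tensor_def)

lemma is_proj_tensor:
  assumes "X \<inter> Y = {}" "is_proj X A" "is_proj Y B"
  shows "is_proj (X \<union> Y) (tensor X Y A B)"
  using assms by (simp add: is_proj_def tensor_mult adj_tensor)

lemma tensor_id_id: "tensor X Y (id_op X) (id_op Y) = id_op (X \<union> Y)"
proof (rule op_eqI[of "X \<union> Y"])
  fix f g assume "f \<in> states (X \<union> Y)" "g \<in> states (X \<union> Y)"
  moreover from this have "f = g" if "restr X f = restr X g" "restr Y f = restr Y g"
    using that merge_restr by metis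
  ultimately show "tensor X Y (id_op X) (id_op Y) f g = id_op (X \<union> Y) f g"
    by (auto simp: tensor_def id_op_def)
qed auto

lemma tensor_commute: "tensor X Y A B = tensor Y X B A"
  by (intro ext) (simp add: tensor_def Un_commute mult.commute)

lemma is_proj_ext:
  assumes "U \<subseteq> X" "finite X" "is_proj U A" shows "is_proj X (ext U X A)"
proof -
  have "is_proj (U \<union> (X - U)) (tensor U (X - U) A (id_op (X - U)))"
    using assms by (intro is_proj_tensor is_proj_id) auto
  with assms(1) show ?thesis by (simp add: ext_def Un_absorb1)
qed

lemma is_op_ext: "U \<subseteq> X \<Longrightarrow> is_op X (ext U X A)"
  using is_op_tensor[of U "X - U"] by (simp add: ext_def Un_absorb1)

lemma mult_ext:
  assumes "U \<subseteq> X" "finite X"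
  shows "mult X (ext U X A) (ext U X B) = ext U X (mult U A B)"
  using tensor_mult[of U "X - U" A "id_op (X - U)" B "id_op (X - U)"] assms
  by (simp add: ext_def Un_absorb1 mult_id_left)

lemma ext_id: "U \<subseteq> X \<Longrightarrow> ext U X (id_op U) = id_op X"
  by (simp add: ext_def tensor_id_id Un_absorb1)

lemma ext_zero: "ext U X zero_op = zero_op"
  by (intro ext) (simp add: ext_def tensor_def zero_op_def)

lemma ext_self: "is_op X A \<Longrightarrow> ext X X A = A"
proof (rule op_eqI[of X])
  fix f g assume "f \<in> states X" "g \<in> states X"
  moreover have "restr {} f = restr {} g" by (simp add: restr_eq_iff)
  ultimately show "ext X X A f g = A f g" by (simp add: ext_def tensor_def id_op_def)
qed (simp_all add: is_op_ext)

lemma ext_ext: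
  assumes "U \<subseteq> Y" "Y \<subseteq> X" shows "ext Y X (ext U Y A) = ext U X A"
proof (rule op_eqI[of X])
  fix f g assume "f \<in> states X" "g \<in> states X"
  moreover have "restr (Y - U) f = restr (Y - U) g \<and> restr (X - Y) f = restr (X - Y) g
      \<longleftrightarrow> restr (X - U) f = restr (X - U) g"
    using assms by (auto simp: restr_eq_iff)
  moreover have "U \<inter> Y = U" "(Y - U) \<inter> Y = Y - U" "U \<union> (Y - U) = Y" "U \<union> (X - U) = X" "Y \<union> (X - Y) = X"
    using assms by auto
  ultimately show "ext Y X (ext U Y A) f g = ext U X A f g"
    by (auto simp: ext_def tensor_def id_op_def restr_restr)
qed (use assms in \<open>auto simp: is_op_ext\<close>)

lemma ext_mono:
  assumes "U \<subseteq> X" "finite X" "is_proj U P" "is_proj U Q" "proj_le U P Q"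
  shows "img X (ext U X P) \<subseteq> img X (ext U X Q)"
  using assms proj_le_iff[of U P Q] proj_le_iff[of X "ext U X P" "ext U X Q"]
  by (simp add: is_proj_ext mult_ext proj_le_def)

text \<open>The two factors commute. Both orders are recorded so that either factor can be brought
  to the front and absorbed by idempotence.\<close>

lemma tensor_eq_mult_ext:
  assumes "X \<inter> Y = {}" "finite X" "finite Y" "is_op X A" "is_op Y B"
  shows "tensor X Y A B = mult (X \<union> Y) (ext X (X \<union> Y) A) (ext Y (X \<union> Y) B)"
    "tensor X Y A B = mult (X \<union> Y) (ext Y (X \<union> Y) B) (ext X (X \<union> Y) A)"
proof -
  have "(X \<union> Y) - X = Y" "(X \<union> Y) - Y = X" using assms by auto
  then have "ext X (X \<union> Y) A = tensor X Y A (id_op Y)" "ext Y (X \<union> Y) B = tensor X Y (id_op X) B"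
    by (simp_all add: ext_def tensor_commute[of Y X])
  then show "tensor X Y A B = mult (X \<union> Y) (ext X (X \<union> Y) A) (ext Y (X \<union> Y) B)"
    "tensor X Y A B = mult (X \<union> Y) (ext Y (X \<union> Y) B) (ext X (X \<union> Y) A)"
    using assms by (simp_all add: tensor_mult mult_id_left mult_id_right)
qed

text \<open>Each factor absorbs the product, so what the product fixes is fixed by both factors.
  This separates a product postcondition into one condition per register.\<close>

lemma tensor_fixes_iff:
  assumes "X \<inter> Y = {}" "finite X" "finite Y" "is_proj X A" "is_proj Y B"
  shows "mult (X \<union> Y) (tensor X Y A B) \<sigma> = \<sigma> \<longleftrightarrow>
    mult (X \<union> Y) (ext X (X \<union> Y) A) \<sigma> = \<sigma> \<and> mult (X \<union> Y) (ext Y (X \<union> Y) B) \<sigma> = \<sigma>"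
proof -
  let ?Z = "X \<union> Y"
  have e: "mult ?Z (ext X ?Z A) (ext X ?Z A) = ext X ?Z A" "mult ?Z (ext Y ?Z B) (ext Y ?Z B) = ext Y ?Z B"
    using assms by (simp_all add: mult_ext is_projD)
  note t = tensor_eq_mult_ext[OF assms(1-3) is_projD(1)[OF assms(4)] is_projD(1)[OF assms(5)]]
  have "mult ?Z (ext X ?Z A) (tensor X Y A B) = tensor X Y A B"
    by (simp only: t(1) e mult_assoc[symmetric])
  moreover have "mult ?Z (ext Y ?Z B) (tensor X Y A B) = tensor X Y A B"
    by (simp only: t(2) e mult_assoc[symmetric])
  ultimately show ?thesis
    by (metis mult_assoc t(1))
qed

lemma img_tensor:
  assumes "X \<inter> Y = {}" "finite X" "finite Y" "is_proj X A" "is_proj Y B"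
  shows "img (X \<union> Y) (tensor X Y A B) = img (X \<union> Y) (ext X (X \<union> Y) A) \<inter> img (X \<union> Y) (ext Y (X \<union> Y) B)"
proof -
  let ?Z = "X \<union> Y"
  have e: "mult ?Z (ext X ?Z A) (ext X ?Z A) = ext X ?Z A" "mult ?Z (ext Y ?Z B) (ext Y ?Z B) = ext Y ?Z B"
    using assms by (simp_all add: mult_ext is_projD)
  note t = tensor_eq_mult_ext[OF assms(1-3) is_projD(1)[OF assms(4)] is_projD(1)[OF assms(5)]]
  have "apply_op ?Z (tensor X Y A B) \<psi> = \<psi> \<longleftrightarrow>
    apply_op ?Z (ext X ?Z A) \<psi> = \<psi> \<and> apply_op ?Z (ext Y ?Z B) \<psi> = \<psi>" for \<psi>
  proof -
    have "apply_op ?Z (ext X ?Z A) (apply_op ?Z (tensor X Y A B) \<psi>) = apply_op ?Z (tensor X Y A B) \<psi>"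
      by (simp only: t(1) e mult_assoc[symmetric] apply_op_mult[symmetric])
    moreover have "apply_op ?Z (ext Y ?Z B) (apply_op ?Z (tensor X Y A B) \<psi>) = apply_op ?Z (tensor X Y A B) \<psi>"
      by (simp only: t(2) e mult_assoc[symmetric] apply_op_mult[symmetric])
    ultimately show ?thesis by (metis apply_op_mult t(1))
  qed
  moreover have "is_proj ?Z (ext X ?Z A)" "is_proj ?Z (ext Y ?Z B)" "is_proj ?Z (tensor X Y A B)"
    using assms by (auto intro: is_proj_ext is_proj_tensor)
  ultimately show ?thesis by (auto simp: img_proj)
qed

definition tvec :: "nat set \<Rightarrow> nat set \<Rightarrow> vec \<Rightarrow> vec \<Rightarrow> vec" where
  "tvec X Y \<alpha> \<beta> = (\<lambda>f. if f \<in> states (X \<union> Y) then \<alpha> (restr X f) * \<beta> (restr Y f) else 0)"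

lemma tvec_in_vecs [simp]: "tvec X Y \<alpha> \<beta> \<in> vecs (X \<union> Y)"
  by (simp add: tvec_def vecs_def)

lemma apply_tensor_tvec:
  assumes "X \<inter> Y = {}"
  shows "apply_op (X \<union> Y) (tensor X Y A B) (tvec X Y \<alpha> \<beta>) = tvec X Y (apply_op X A \<alpha>) (apply_op Y B \<beta>)"
proof
  fix f
  show "apply_op (X \<union> Y) (tensor X Y A B) (tvec X Y \<alpha> \<beta>) f = tvec X Y (apply_op X A \<alpha>) (apply_op Y B \<beta>) f"
  proof (cases "f \<in> states (X \<union> Y)")
    case True
    have "(\<Sum>g\<in>states (X \<union> Y). tensor X Y A B f g * tvec X Y \<alpha> \<beta> g) =
      (\<Sum>u\<in>states X. \<Sum>v\<in>states Y. (A (restr X f) u * B (restr Y f) v) * (\<alpha> u * \<beta> v))"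
      unfolding sum_states_Un[OF assms]
      by (intro sum.cong refl) (use assms True in \<open>simp add: tensor_def tvec_def merge_in restr_merge2\<close>)
    also have "\<dots> = (\<Sum>u\<in>states X. A (restr X f) u * \<alpha> u) * (\<Sum>v\<in>states Y. B (restr Y f) v * \<beta> v)"
      by (simp add: sum_product mult_ac)
    finally show ?thesis using True by (simp add: apply_op_def tvec_def)
  qed (simp add: apply_op_def tvec_def)
qed

lemma tvec_in_img_tensor:
  assumes "X \<inter> Y = {}" "is_proj X A" "is_proj Y B" "\<alpha> \<in> img X A" "\<beta> \<in> img Y B"
  shows "tvec X Y \<alpha> \<beta> \<in> img (X \<union> Y) (tensor X Y A B)"
  using assms by (simp add: img_proj is_proj_tensor apply_tensor_tvec)

text \<open>The columns of \<open>A \<otimes> B\<close> are products of columns of \<open>A\<close>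
  and \<open>B\<close>, so product vectors span the image and a subspace need only be tested on
  them.\<close>

lemma img_tensor_subset:
  assumes fin: "finite X" "finite Y" and A: "is_proj X A" and B: "is_proj Y B" and N: "subsp N"
    and *: "\<And>\<alpha> \<beta>. \<alpha> \<in> img X A \<Longrightarrow> \<beta> \<in> img Y B \<Longrightarrow> tvec X Y \<alpha> \<beta> \<in> N"
  shows "img (X \<union> Y) (tensor X Y A B) \<subseteq> N"
proof
  fix \<psi> assume "\<psi> \<in> img (X \<union> Y) (tensor X Y A B)"
  then obtain \<phi> where "\<psi> = apply_op (X \<union> Y) (tensor X Y A B) \<phi>" by (auto simp: img_def)
  also have "\<dots> = (\<lambda>f. \<Sum>h\<in>states (X \<union> Y). \<phi> h * tvec X Y (\<lambda>u. A u (restr X h)) (\<lambda>v. B v (restr Y h)) f)"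
    by (intro ext) (auto simp: apply_op_def tensor_def tvec_def mult.commute intro!: sum.cong)
  also have "\<dots> \<in> N"
    by (intro subsp_sum subspD(3) N * proj_col_in_img A B) (use fin in simp)
  finally show "\<psi> \<in> N" .
qed

text \<open>With \<open>\<beta>\<close> fixed this is the preimage of a subspace under a linear map.
  It lets a property of product vectors pass from generators of the left factor to their
  span.\<close>

lemma subsp_tvec_left: assumes "subsp N" shows "subsp {\<alpha>. tvec X Y \<alpha> \<beta> \<in> N}"
proof -
  have 1: "tvec X Y (\<lambda>_. 0) \<beta> = (\<lambda>_. 0)" by (intro ext) (simp add: tvec_def)
  have 2: "tvec X Y (\<lambda>f. u f + v f) \<beta> = (\<lambda>f. tvec X Y u \<beta> f + tvec X Y v \<beta> f)" for u v
    by (intro ext) (simp add: tvec_def algebra_simps)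
  have 3: "tvec X Y (\<lambda>f. c * u f) \<beta> = (\<lambda>f. c * tvec X Y u \<beta> f)" for c u
    by (intro ext) (simp add: tvec_def algebra_simps)
  show ?thesis using assms unfolding subsp_def by (simp add: 1 2 3)
qed

subsection \<open>Slices and blocks\<close>

text \<open>The partial inner product of \<open>\<psi>\<close> with the basis state \<open>a\<close>
  of the registers outside \<open>Y\<close>.\<close>

definition slice :: "nat set \<Rightarrow> vec \<Rightarrow> basis \<Rightarrow> vec" where
  "slice Y \<psi> a = (\<lambda>u. if u \<in> states Y then \<psi> (merge Y u a) else 0)"

lemma slice_in_vecs [simp]: "slice Y \<psi> a \<in> vecs Y"
  by (simp add: slice_def vecs_def)

lemma vec_eqI_slice:
  assumes "Y \<subseteq> X" "\<psi> \<in> vecs X" "\<phi> \<in> vecs X"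
    "\<And>a. a \<in> states (X - Y) \<Longrightarrow> slice Y \<psi> a = slice Y \<phi> a"
  shows "\<psi> = \<phi>"
proof
  fix f show "\<psi> f = \<phi> f"
  proof (cases "f \<in> states X")
    case True
    have "slice Y \<psi> (restr (X - Y) f) (restr Y f) = slice Y \<phi> (restr (X - Y) f) (restr Y f)"
      using assms(4) by simp
    then show ?thesis using True assms(1) by (simp add: slice_def merge_restr_Diff)
  qed (use assms in \<open>simp add: vecs_def\<close>)
qed

lemma ext_merge:
  assumes "Y \<subseteq> X" "u \<in> states Y" "v \<in> states Y" "a \<in> states (X - Y)" "b \<in> states (X - Y)"
  shows "ext Y X A (merge Y u a) (merge Y v b) = (if a = b then A u v else 0)"
  using assms by (simp add: ext_def tensor_def id_op_def Un_absorb1 merge_in_Diff)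

lemma sum_ext:
  assumes "Y \<subseteq> X" "finite X" "u \<in> states Y" "a \<in> states (X - Y)"
  shows "(\<Sum>h\<in>states X. ext Y X A (merge Y u a) h * \<phi> h) = (\<Sum>v\<in>states Y. A u v * \<phi> (merge Y v a))"
proof -
  have "(\<Sum>h\<in>states X. ext Y X A (merge Y u a) h * \<phi> h)
      = (\<Sum>v\<in>states Y. \<Sum>b\<in>states (X - Y). if a = b then A u v * \<phi> (merge Y v b) else 0)"
    unfolding sum_states_Diff[OF assms(1)]
    by (intro sum.cong refl) (use assms in \<open>simp add: ext_merge\<close>)
  also have "\<dots> = (\<Sum>v\<in>states Y. A u v * \<phi> (merge Y v a))"
    using assms by simp
  finally show ?thesis .
qed

lemma slice_apply_ext:
  assumes "Y \<subseteq> X" "finite X" "a \<in> states (X - Y)"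
  shows "slice Y (apply_op X (ext Y X A) \<psi>) a = apply_op Y A (slice Y \<psi> a)"
  using assms by (intro ext) (simp add: slice_def apply_op_def merge_in_Diff sum_ext)

text \<open>\<open>A \<otimes> I\<close> acts on every slice separately, and a vector is determined
  by its slices.\<close>

lemma img_ext_iff:
  assumes "Y \<subseteq> X" "finite X" "is_proj Y A" "\<psi> \<in> vecs X"
  shows "\<psi> \<in> img X (ext Y X A) \<longleftrightarrow> (\<forall>a\<in>states (X - Y). slice Y \<psi> a \<in> img Y A)"
proof -
  have "apply_op X (ext Y X A) \<psi> = \<psi> \<longleftrightarrow>
      (\<forall>a\<in>states (X - Y). slice Y (apply_op X (ext Y X A) \<psi>) a = slice Y \<psi> a)"
    using vec_eqI_slice[OF assms(1) apply_op_in_vecs assms(4)] by metis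
  then show ?thesis using assms
    by (simp add: img_proj is_proj_ext slice_apply_ext)
qed

lemma is_op_block [simp]: "is_op Y (block Y \<rho> a b)"
  by (auto simp: is_op_def block_def)

lemma block_mult_ext:
  assumes "Y \<subseteq> X" "finite X" "is_op Y A" "a \<in> states (X - Y)"
  shows "block Y (mult X (ext Y X A) \<rho>) a b = mult Y A (block Y \<rho> a b)"
proof (rule op_eqI[of Y])
  fix u v assume "u \<in> states Y" "v \<in> states Y"
  then show "block Y (mult X (ext Y X A) \<rho>) a b u v = mult Y A (block Y \<rho> a b) u v"
    using assms by (simp add: block_def mult_def sum_ext)
qed (use assms in auto)

lemma block_outer: "block Y (outer \<phi> \<psi>) a b = outer (slice Y \<phi> a) (slice Y \<psi> b)"
  by (intro ext) (simp add: block_def outer_def slice_def)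

lemma block_add: "block Y (\<lambda>f g. \<rho> f g + \<sigma> f g) a b = (\<lambda>f g. block Y \<rho> a b f g + block Y \<sigma> a b f g)"
  by (intro ext) (simp add: block_def)

lemma block_scale: "block Y (\<lambda>f g. c * \<rho> f g) a b = (\<lambda>f g. c * block Y \<rho> a b f g)"
  by (intro ext) (simp add: block_def)

lemma trace_blocks:
  assumes "Y \<subseteq> X"
  shows "trace X \<rho> = (\<Sum>a\<in>states (X - Y). trace Y (block Y \<rho> a a))"
  unfolding trace_def sum_states_Diff[OF assms]
  by (subst sum.swap) (simp add: block_def)

text \<open>The form of a diagonal block at \<open>\<psi>\<close> is the form of
  \<open>\<rho>\<close> at the product of \<open>\<psi>\<close> with the basis state
  \<open>a\<close>.\<close>

lemma positive_block:
  assumes Y: "Y \<subseteq> X" and X: "finite X" and \<rho>: "positive X \<rho>" and a: "a \<in> states (X - Y)"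
  shows "positive Y (block Y \<rho> a a)"
proof -
  have "0 \<le> sesq Y (block Y \<rho> a a) \<psi> \<psi>" for \<psi>
  proof -
    \<comment> \<open>This is that product vector: it is supported where the registers outside
      \<open>Y\<close> are in state \<open>a\<close>.\<close>
    define \<phi> where "\<phi> h = (if restr (X - Y) h = a then \<psi> (restr Y h) else 0)" for h
    have 1: "(\<Sum>h\<in>states X. cnj (\<phi> h) * k h) = (\<Sum>u\<in>states Y. cnj (\<psi> u) * k (merge Y u a))" for k
      unfolding sum_states_Diff[OF Y]
      using X a by (simp add: \<phi>_def if_distrib[of cnj] if_distrib[of "\<lambda>x. x * _"] sum.delta cong: if_cong)
    have 2: "(\<Sum>h\<in>states X. k h * \<phi> h) = (\<Sum>u\<in>states Y. k (merge Y u a) * \<psi> u)" for k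
      unfolding sum_states_Diff[OF Y]
      using X a by (simp add: \<phi>_def if_distrib[of "\<lambda>x. _ * x"] sum.delta cong: if_cong)
    have "sesq X \<rho> \<phi> \<phi> = (\<Sum>f\<in>states X. cnj (\<phi> f) * (\<Sum>g\<in>states X. \<rho> f g * \<phi> g))"
      by (simp add: sesq_def sum_distrib_left mult.assoc)
    also have "\<dots> = (\<Sum>u\<in>states Y. cnj (\<psi> u) * (\<Sum>v\<in>states Y. \<rho> (merge Y u a) (merge Y v a) * \<psi> v))"
      by (simp only: 1 2)
    also have "\<dots> = sesq Y (block Y \<rho> a a) \<psi> \<psi>"
      by (simp add: sesq_def block_def sum_distrib_left mult.assoc)
    finally show ?thesis using \<rho> by (metis positive_iff)
  qed
  then show ?thesis by (simp add: positive_iff)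
qed

subsection \<open>Programs\<close>

lemma DProgD:
  assumes "E \<in> DProg V"
  shows "is_op V A \<Longrightarrow> is_op V (E A)"
    "is_op V A \<Longrightarrow> is_op V B \<Longrightarrow> E (\<lambda>f g. A f g + B f g) = (\<lambda>f g. E A f g + E B f g)"
    "is_op V A \<Longrightarrow> E (\<lambda>f g. c * A f g) = (\<lambda>f g. c * E A f g)"
    "finite X \<Longrightarrow> V \<subseteq> X \<Longrightarrow> positive X \<rho> \<Longrightarrow> positive X (sop_ext V X E \<rho>)"
    "positive V \<rho> \<Longrightarrow> trace V (E \<rho>) \<le> trace V \<rho>"
  using assms unfolding DProg_def by simp_all

lemma is_op_sop_ext [simp]: "is_op X (sop_ext V X E \<rho>)"
  by (auto simp: is_op_def sop_ext_def)

lemma block_sop_ext: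
  assumes "\<And>A. is_op V A \<Longrightarrow> is_op V (E A)" "V \<subseteq> X" "a \<in> states (X - V)" "b \<in> states (X - V)"
  shows "block V (sop_ext V X E \<rho>) a b = E (block V \<rho> a b)"
proof (rule op_eqI[of V])
  fix u v assume uv: "u \<in> states V" "v \<in> states V"
  then have "block V (sop_ext V X E \<rho>) a b u v = sop_ext V X E \<rho> (merge V u a) (merge V v b)"
    by (simp add: block_def)
  also have "\<dots> = E (block V \<rho> a b) u v"
    using assms uv by (simp add: sop_ext_def merge_in_Diff)
  finally show "block V (sop_ext V X E \<rho>) a b u v = E (block V \<rho> a b) u v" .
qed (use assms in auto)

text \<open>Extension in two stages is extension in one, since a block of a block is a block of the
  whole operator. It allows \<open>Y\<close> to replace \<open>V\<close> as the home of the
  program.\<close>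

lemma sop_ext_trans:
  assumes "V \<subseteq> Y" "Y \<subseteq> X"
  shows "sop_ext Y X (sop_ext V Y E) \<rho> = sop_ext V X E \<rho>"
proof (rule op_eqI[of X])
  fix f g assume fg: "f \<in> states X" "g \<in> states X"
  have m: "merge Y (merge V u (restr (Y - V) (restr Y f))) (restr (X - Y) f) = merge V u (restr (X - V) f)" for u f
    using assms by (auto simp: merge_def restr_def fun_eq_iff)
  have b: "block V (block Y \<rho> (restr (X - Y) f) (restr (X - Y) g)) (restr (Y - V) (restr Y f)) (restr (Y - V) (restr Y g))
      = block V \<rho> (restr (X - V) f) (restr (X - V) g)"
    by (intro ext) (use assms in \<open>simp add: block_def merge_in_Diff m\<close>)
  have "V \<inter> Y = V" using assms by auto
  then show "sop_ext Y X (sop_ext V Y E) \<rho> f g = sop_ext V X E \<rho> f g"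
    using fg by (simp add: sop_ext_def[of Y X] sop_ext_def[of V X] sop_ext_def[of V Y] b)
      (simp add: restr_restr)
qed auto

text \<open>Complete positivity is inherited by extending in stages. The trace bound is stated only
  on \<open>V\<close>, and is recovered on \<open>Y\<close> by summing over diagonal blocks, each of
  them positive.\<close>

lemma DProg_sop_ext:
  assumes E: "E \<in> DProg V" and V: "V \<subseteq> Y" and Y: "finite Y"
  shows "sop_ext V Y E \<in> DProg Y"
proof -
  have "sop_ext V Y E (\<lambda>f g. A f g + B f g) = (\<lambda>f g. sop_ext V Y E A f g + sop_ext V Y E B f g)" for A B
    by (intro ext) (simp add: sop_ext_def block_add DProgD[OF E])
  moreover have "sop_ext V Y E (\<lambda>f g. c * A f g) = (\<lambda>f g. c * sop_ext V Y E A f g)" for c A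
    by (intro ext) (simp add: sop_ext_def block_scale DProgD[OF E])
  moreover have "positive X (sop_ext Y X (sop_ext V Y E) \<rho>)" if "finite X" "Y \<subseteq> X" "positive X \<rho>" for X \<rho>
    using that V by (simp add: sop_ext_trans DProgD(4)[OF E])
  moreover have "trace Y (sop_ext V Y E \<rho>) \<le> trace Y \<rho>" if \<rho>: "positive Y \<rho>" for \<rho>
  proof -
    have "trace Y (sop_ext V Y E \<rho>) = (\<Sum>a\<in>states (Y - V). trace V (E (block V \<rho> a a)))"
      unfolding trace_blocks[OF V]
      by (intro sum.cong refl) (simp add: block_sop_ext[OF DProgD(1)[OF E] V])
    also have "\<dots> \<le> (\<Sum>a\<in>states (Y - V). trace V (block V \<rho> a a))"
      by (intro sum_mono DProgD(5)[OF E] positive_block[OF V Y \<rho>])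
    also have "\<dots> = trace Y \<rho>" by (rule trace_blocks[OF V, symmetric])
    finally show ?thesis .
  qed
  ultimately show ?thesis unfolding DProg_def by simp
qed

text \<open>The ancilla is the empty register here, and its only basis state is constantly false.
  Positivity of a program on its own register is read off from complete positivity in this
  way.\<close>

lemma sop_ext_self:
  assumes "is_op X \<rho>" "is_op X (E \<rho>)" shows "sop_ext X X E \<rho> = E \<rho>"
proof -
  have m: "merge X u a = u" if "u \<in> states X" "a \<in> states {}" for u a
    using that by (auto simp: merge_def states_def)
  have "block X \<rho> a b = \<rho>" if "a \<in> states {}" "b \<in> states {}" for a b
    by (rule op_eqI[of X]) (use assms that in \<open>simp_all add: m\<close>, simp add: block_def m)
  then show ?thesis
    using assms by (intro op_eqI[of X]) (simp_all, simp add: sop_ext_def)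
qed

lemma DProg_positive:
  assumes "F \<in> DProg X" "finite X" "positive X \<rho>" shows "positive X (F \<rho>)"
  using DProgD(4)[OF assms(1,2) order_refl assms(3)] assms
  by (simp add: sop_ext_self DProgD positive_iff)

lemma DProg_zero: "F \<in> DProg X \<Longrightarrow> F zero_op = zero_op"
  using DProgD(3)[of F X zero_op 0] by (simp add: zero_op_def[abs_def]) (simp flip: zero_op_def)

lemma DProg_lin_on: "F \<in> DProg X \<Longrightarrow> lin_on X (\<lambda>\<rho>. F \<rho> f g)"
  by (simp add: lin_on_def DProgD(2,3))

lemma lin_on_trace_mult: "F \<in> DProg X \<Longrightarrow> lin_on X (\<lambda>\<rho>. trace X (mult X A (F \<rho>)))"
  by (simp add: lin_on_def DProgD(2,3) mult_add_right mult_scale_right trace_add trace_scale)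

lemma lin_on_trace_prog: "F \<in> DProg X \<Longrightarrow> lin_on X (\<lambda>\<rho>. trace X (F \<rho>))"
  by (simp add: lin_on_def DProgD(2,3) trace_add trace_scale)

lemma lin_on_trace: "lin_on X (trace X)"
  by (simp add: lin_on_def trace_add trace_scale)

section \<open>Effects and subspaces attached to a program and a postcondition\<close>

definition par_space :: "nat set \<Rightarrow> sop \<Rightarrow> op \<Rightarrow> vec set" where
  "par_space X F Q = {\<psi> \<in> vecs X. mult X Q (F (outer \<psi> \<psi>)) = F (outer \<psi> \<psi>)}"

definition tot_space :: "nat set \<Rightarrow> sop \<Rightarrow> op \<Rightarrow> vec set" where
  "tot_space X F Q = {\<psi> \<in> par_space X F Q. trace X (F (outer \<psi> \<psi>)) = trace X (outer \<psi> \<psi>)}"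

definition par_eff :: "nat set \<Rightarrow> sop \<Rightarrow> op \<Rightarrow> op \<Rightarrow> complex" where
  "par_eff X F Q \<rho> = trace X (F \<rho>) - trace X (mult X Q (F \<rho>))"

definition tot_eff :: "nat set \<Rightarrow> sop \<Rightarrow> op \<Rightarrow> op \<Rightarrow> complex" where
  "tot_eff X F Q \<rho> = trace X \<rho> - trace X (mult X Q (F \<rho>))"

context
  fixes X :: "nat set" and F :: sop and Q :: op
  assumes X: "finite X" and F: "F \<in> DProg X" and Q: "is_proj X Q"
begin

lemma prog_trace_bounds:
  assumes "positive X \<rho>"
  shows "0 \<le> trace X (mult X Q (F \<rho>))" "trace X (mult X Q (F \<rho>)) \<le> trace X (F \<rho>)"
    "trace X (F \<rho>) \<le> trace X \<rho>"
  using trace_proj_nonneg[OF Q] trace_proj_le[OF X Q] DProg_positive[OF F X assms] DProgD(5)[OF F assms]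
  by blast+

lemma effect_par_eff: "effect X (par_eff X F Q)"
  unfolding effect_def
proof (intro conjI allI impI)
  show "lin_on X (par_eff X F Q)"
    unfolding par_eff_def[abs_def] by (intro lin_on_diff lin_on_trace_prog lin_on_trace_mult F)
  fix \<rho> assume "positive X \<rho>"
  then show "0 \<le> par_eff X F Q \<rho>" "par_eff X F Q \<rho> \<le> trace X \<rho>"
    using prog_trace_bounds[of \<rho>] by (auto simp: par_eff_def less_eq_complex_def)
qed

lemma effect_tot_eff: "effect X (tot_eff X F Q)"
  unfolding effect_def
proof (intro conjI allI impI)
  show "lin_on X (tot_eff X F Q)"
    unfolding tot_eff_def[abs_def] by (intro lin_on_diff lin_on_trace lin_on_trace_mult F)
  fix \<rho> assume "positive X \<rho>"
  then show "0 \<le> tot_eff X F Q \<rho>" "tot_eff X F Q \<rho> \<le> trace X \<rho>"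
    using prog_trace_bounds[of \<rho>] by (auto simp: tot_eff_def less_eq_complex_def)
qed

lemma null_space_par_eff: "null_space X (par_eff X F Q) = par_space X F Q"
proof -
  have "par_eff X F Q (outer \<psi> \<psi>) = 0 \<longleftrightarrow> mult X Q (F (outer \<psi> \<psi>)) = F (outer \<psi> \<psi>)" if "\<psi> \<in> vecs X" for \<psi>
    using trace_proj_eq_iff[OF X Q DProg_positive[OF F X positive_outer[OF that]]]
    by (auto simp: par_eff_def)
  then show ?thesis by (auto simp: null_space_def par_space_def)
qed

text \<open>The total defect is the trace lost by \<open>F\<close> plus the trace of the output
  outside \<open>Q\<close>. Both are nonnegative on positive operators, so the sum vanishes only if
  each does.\<close>

lemma null_space_tot_eff: "null_space X (tot_eff X F Q) = tot_space X F Q"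
proof -
  have "tot_eff X F Q (outer \<psi> \<psi>) = 0 \<longleftrightarrow>
      mult X Q (F (outer \<psi> \<psi>)) = F (outer \<psi> \<psi>) \<and> trace X (F (outer \<psi> \<psi>)) = trace X (outer \<psi> \<psi>)"
    if "\<psi> \<in> vecs X" for \<psi>
    using trace_proj_eq_iff[OF X Q DProg_positive[OF F X positive_outer[OF that]]]
      prog_trace_bounds[OF positive_outer[OF that]]
    by (auto simp: tot_eff_def)
  then show ?thesis by (auto simp: null_space_def par_space_def tot_space_def)
qed

text \<open>The defining equation is quadratic in \<open>\<psi>\<close>; linearity of the solution
  set is visible only through the null space of the effect.\<close>

lemma subsp_par_space: "subsp (par_space X F Q)"
  using subsp_null_space[OF X effect_par_eff] by (simp add: null_space_par_eff)

lemma subsp_tot_space: "subsp (tot_space X F Q)"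
  using subsp_null_space[OF X effect_tot_eff] by (simp add: null_space_tot_eff)

lemma par_space_vecs: "par_space X F Q \<subseteq> vecs X"
  by (auto simp: par_space_def)

lemma tot_space_vecs: "tot_space X F Q \<subseteq> vecs X"
  by (auto simp: par_space_def tot_space_def)

lemma par_space_iff_cols:
  "\<psi> \<in> par_space X F Q \<longleftrightarrow> \<psi> \<in> vecs X \<and> (\<forall>g. (\<lambda>h. F (outer \<psi> \<psi>) h g) \<in> img X Q)"
  by (auto simp: par_space_def proj_fixes_iff Q DProgD(1)[OF F])

end

subsection \<open>Satisfaction on the smallest system\<close>

text \<open>The tested inequality is homogeneous in \<open>\<rho>\<close>, so the bound on the trace
  can be scaled away.\<close>

lemma all_pdo_iff_all_positive:
  assumes X: "finite X" and \<delta>: "\<And>c \<rho>. is_op X \<rho> \<Longrightarrow> \<delta> (\<lambda>f g. c * \<rho> f g) = c * \<delta> \<rho>"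
  shows "(\<forall>\<rho>. pdo X \<rho> \<longrightarrow> 0 \<le> \<delta> \<rho>) \<longleftrightarrow> (\<forall>\<rho>. positive X \<rho> \<longrightarrow> 0 \<le> \<delta> \<rho>)"
proof (intro iffI allI impI)
  fix \<rho> assume *: "\<forall>\<rho>. pdo X \<rho> \<longrightarrow> 0 \<le> \<delta> \<rho>" and \<rho>: "positive X \<rho>"
  \<comment> \<open>The added \<open>1\<close> keeps the denominator positive when the trace is
    zero, and the scaled trace still stays below one.\<close>
  define c where "c = 1 / (1 + Re (trace X \<rho>))"
  have t: "0 \<le> Re (trace X \<rho>)" "Im (trace X \<rho>) = 0"
    using positive_trace_nonneg[OF X \<rho>] by (auto simp: less_eq_complex_def)
  then have c: "c > 0" by (simp add: c_def)
  have "c * Re (trace X \<rho>) \<le> 1" using t by (simp add: c_def field_simps)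
  then have "trace X (\<lambda>f g. complex_of_real c * \<rho> f g) \<le> 1"
    using t by (simp add: trace_scale less_eq_complex_def)
  then have "pdo X (\<lambda>f g. complex_of_real c * \<rho> f g)"
    using \<rho> c unfolding pdo_def by (intro conjI positive_scale) (auto simp: less_eq_complex_def)
  with * \<delta> \<rho> have "0 \<le> complex_of_real c * \<delta> \<rho>" by (metis positive_iff)
  with c show "0 \<le> \<delta> \<rho>" by (simp add: less_eq_complex_def zero_le_mult_iff)
qed (auto simp: pdo_def)

lemma trace_ext_mult_blocks:
  assumes "U \<subseteq> Y" "Y \<subseteq> X" "finite X"
  shows "trace X (mult X (ext U X A) \<rho>) = (\<Sum>a\<in>states (X - Y). trace Y (mult Y (ext U Y A) (block Y \<rho> a a)))"
  unfolding trace_blocks[OF assms(2)] ext_ext[OF assms(1,2), symmetric]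
  by (intro sum.cong refl) (use assms in \<open>simp add: block_mult_ext is_op_ext\<close>)

lemma block_sop_ext_trans:
  assumes "V \<subseteq> Y" "Y \<subseteq> X" "a \<in> states (X - Y)" "b \<in> states (X - Y)"
  shows "block Y (sop_ext V X E \<rho>) a b = sop_ext V Y E (block Y \<rho> a b)"
  unfolding sop_ext_trans[OF assms(1,2), symmetric] by (rule block_sop_ext) (use assms in auto)

context
  fixes V UP UQ Y :: "nat set" and E :: sop and P Q :: op
  assumes fin: "finite V" "finite UP" "finite UQ" and E: "E \<in> DProg V"
    and P: "is_proj UP P" and Q: "is_proj UQ Q" and Y: "Y = V \<union> UP \<union> UQ"
begin

lemma base_system:
  shows base_finite: "finite Y" and base_prog: "sop_ext V Y E \<in> DProg Y"
    and base_P: "is_proj Y (ext UP Y P)" and base_Q: "is_proj Y (ext UQ Y Q)"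
  using fin E P Q unfolding Y by (auto intro!: DProg_sop_ext is_proj_ext)

lemma trace_base_split:
  assumes "finite X" "Y \<subseteq> X"
  shows "trace X (mult X (ext UP X P) \<rho>) = (\<Sum>a\<in>states (X - Y). trace Y (mult Y (ext UP Y P) (block Y \<rho> a a)))"
    "trace X (mult X (ext UQ X Q) (sop_ext V X E \<rho>))
      = (\<Sum>a\<in>states (X - Y). trace Y (mult Y (ext UQ Y Q) (sop_ext V Y E (block Y \<rho> a a))))"
    "trace X (sop_ext V X E \<rho>) = (\<Sum>a\<in>states (X - Y). trace Y (sop_ext V Y E (block Y \<rho> a a)))"
proof -
  have sub: "V \<subseteq> Y" "UP \<subseteq> Y" "UQ \<subseteq> Y" by (auto simp: Y)
  note b = block_sop_ext_trans[OF sub(1) assms(2)]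
  show "trace X (mult X (ext UP X P) \<rho>) = (\<Sum>a\<in>states (X - Y). trace Y (mult Y (ext UP Y P) (block Y \<rho> a a)))"
    by (rule trace_ext_mult_blocks[OF sub(2) assms(2,1)])
  show "trace X (mult X (ext UQ X Q) (sop_ext V X E \<rho>))
      = (\<Sum>a\<in>states (X - Y). trace Y (mult Y (ext UQ Y Q) (sop_ext V Y E (block Y \<rho> a a))))"
    unfolding trace_ext_mult_blocks[OF sub(3) assms(2,1)] by (simp add: b)
  show "trace X (sop_ext V X E \<rho>) = (\<Sum>a\<in>states (X - Y). trace Y (sop_ext V Y E (block Y \<rho> a a)))"
    unfolding trace_blocks[OF assms(2)] by (simp add: b)
qed

lemma sat_tot_iff:
  "sat_tot V E UP P UQ Q \<longleftrightarrow> img Y (ext UP Y P) \<subseteq> tot_space Y (sop_ext V Y E) (ext UQ Y Q)"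
proof -
  let ?\<delta> = "\<lambda>X \<rho>. trace X (mult X (ext UQ X Q) (sop_ext V X E \<rho>)) - trace X (mult X (ext UP X P) \<rho>)"
  have split: "?\<delta> X \<rho> = (\<Sum>a\<in>states (X - Y). ?\<delta> Y (block Y \<rho> a a))" if "finite X" "Y \<subseteq> X" for X \<rho>
    unfolding trace_base_split[OF that] by (simp add: sum_subtractf)
  have "sat_tot V E UP P UQ Q \<longleftrightarrow> (\<forall>X. finite X \<longrightarrow> Y \<subseteq> X \<longrightarrow> (\<forall>\<rho>. pdo X \<rho> \<longrightarrow> 0 \<le> ?\<delta> X \<rho>))"
    by (auto simp: sat_tot_def Y)
  also have "\<dots> \<longleftrightarrow> (\<forall>X. finite X \<longrightarrow> Y \<subseteq> X \<longrightarrow> (\<forall>\<rho>. positive X \<rho> \<longrightarrow> 0 \<le> ?\<delta> X \<rho>))"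
  proof (rule all_cong1, rule imp_cong[OF refl], rule imp_cong[OF refl], rule all_pdo_iff_all_positive)
    fix X c \<rho> assume "finite X" "Y \<subseteq> X"
    then have "sop_ext V X E \<in> DProg X" using E unfolding Y by (auto intro: DProg_sop_ext)
    moreover assume "is_op X \<rho>"
    ultimately show "?\<delta> X (\<lambda>f g. c * \<rho> f g) = c * ?\<delta> X \<rho>"
      by (simp add: DProgD(3) mult_scale_right trace_scale algebra_simps)
  qed
  also have "\<dots> \<longleftrightarrow> (\<forall>\<rho>. positive Y \<rho> \<longrightarrow> 0 \<le> ?\<delta> Y \<rho>)"
  proof (intro iffI allI impI)
    fix X \<rho> assume *: "\<forall>\<rho>. positive Y \<rho> \<longrightarrow> 0 \<le> ?\<delta> Y \<rho>" and X: "finite X" "Y \<subseteq> X" "positive X \<rho>"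
    show "0 \<le> ?\<delta> X \<rho>"
      unfolding split[OF X(1,2)] by (rule sum_nonneg) (use * X positive_block in blast)
  qed (use base_finite in auto)
  also have "\<dots> \<longleftrightarrow> (\<forall>\<rho>. positive Y \<rho> \<longrightarrow>
      trace Y (mult Y (ext UP Y P) \<rho>) \<le> trace Y \<rho> - tot_eff Y (sop_ext V Y E) (ext UQ Y Q) \<rho>)"
    by (simp add: tot_eff_def)
  also have "\<dots> \<longleftrightarrow> img Y (ext UP Y P) \<subseteq> tot_space Y (sop_ext V Y E) (ext UQ Y Q)"
    unfolding null_space_tot_eff[OF base_finite base_prog base_Q, symmetric]
    by (intro effect_le_compl_iff effect_tot_eff base_system)
  finally show ?thesis .
qed

lemma sat_par_iff:
  "sat_par V E UP P UQ Q \<longleftrightarrow> img Y (ext UP Y P) \<subseteq> par_space Y (sop_ext V Y E) (ext UQ Y Q)"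
proof -
  let ?\<delta> = "\<lambda>X \<rho>. trace X (mult X (ext UQ X Q) (sop_ext V X E \<rho>)) + trace X \<rho> - trace X (sop_ext V X E \<rho>)
    - trace X (mult X (ext UP X P) \<rho>)"
  have split: "?\<delta> X \<rho> = (\<Sum>a\<in>states (X - Y). ?\<delta> Y (block Y \<rho> a a))" if "finite X" "Y \<subseteq> X" for X \<rho>
    unfolding trace_base_split[OF that] trace_blocks[OF that(2), of \<rho>]
    by (simp add: sum_subtractf sum.distrib)
  have "sat_par V E UP P UQ Q \<longleftrightarrow> (\<forall>X. finite X \<longrightarrow> Y \<subseteq> X \<longrightarrow> (\<forall>\<rho>. pdo X \<rho> \<longrightarrow> 0 \<le> ?\<delta> X \<rho>))"
    by (auto simp: sat_par_def Y)
  also have "\<dots> \<longleftrightarrow> (\<forall>X. finite X \<longrightarrow> Y \<subseteq> X \<longrightarrow> (\<forall>\<rho>. positive X \<rho> \<longrightarrow> 0 \<le> ?\<delta> X \<rho>))"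
  proof (rule all_cong1, rule imp_cong[OF refl], rule imp_cong[OF refl], rule all_pdo_iff_all_positive)
    fix X c \<rho> assume "finite X" "Y \<subseteq> X"
    then have "sop_ext V X E \<in> DProg X" using E unfolding Y by (auto intro: DProg_sop_ext)
    moreover assume "is_op X \<rho>"
    ultimately show "?\<delta> X (\<lambda>f g. c * \<rho> f g) = c * ?\<delta> X \<rho>"
      by (simp add: DProgD(3) mult_scale_right trace_scale algebra_simps)
  qed
  also have "\<dots> \<longleftrightarrow> (\<forall>\<rho>. positive Y \<rho> \<longrightarrow> 0 \<le> ?\<delta> Y \<rho>)"
  proof (intro iffI allI impI)
    fix X \<rho> assume *: "\<forall>\<rho>. positive Y \<rho> \<longrightarrow> 0 \<le> ?\<delta> Y \<rho>" and X: "finite X" "Y \<subseteq> X" "positive X \<rho>"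
    show "0 \<le> ?\<delta> X \<rho>"
      unfolding split[OF X(1,2)] by (rule sum_nonneg) (use * X positive_block in blast)
  qed (use base_finite in auto)
  also have "\<dots> \<longleftrightarrow> (\<forall>\<rho>. positive Y \<rho> \<longrightarrow>
      trace Y (mult Y (ext UP Y P) \<rho>) \<le> trace Y \<rho> - par_eff Y (sop_ext V Y E) (ext UQ Y Q) \<rho>)"
    by (simp add: par_eff_def algebra_simps)
  also have "\<dots> \<longleftrightarrow> img Y (ext UP Y P) \<subseteq> par_space Y (sop_ext V Y E) (ext UQ Y Q)"
    unfolding null_space_par_eff[OF base_finite base_prog base_Q, symmetric]
    by (intro effect_le_compl_iff effect_par_eff base_system)
  finally show ?thesis .
qed

end

subsection \<open>The predicate transformers\<close>

text \<open>Once satisfaction means inclusion of the image in a fixed subspace \<open>N\<close>, the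
  projector onto \<open>N\<close> satisfies it and dominates all others. This resolves the
  \<open>THE\<close> in \<open>wp\<close> and \<open>wlp\<close>.\<close>

lemma the_largest_proj:
  assumes X: "finite X" and N: "subsp N" "N \<subseteq> vecs X"
    and S: "\<And>P. is_proj X P \<Longrightarrow> S P \<longleftrightarrow> img X P \<subseteq> N"
  shows "(THE P. is_proj X P \<and> S P \<and> (\<forall>P'. is_proj X P' \<and> S P' \<longrightarrow> proj_le X P' P)) = proj_of X N"
proof (rule the_equality)
  note K = proj_of_props[OF X N]
  have SK: "S (proj_of X N)" using K by (simp add: S)
  moreover have "proj_le X P' (proj_of X N)" if "is_proj X P'" "S P'" for P'
    using that S[OF that(1)] K(2) by (simp add: proj_le_def)
  ultimately show "is_proj X (proj_of X N) \<and> S (proj_of X N) \<and>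
      (\<forall>P'. is_proj X P' \<and> S P' \<longrightarrow> proj_le X P' (proj_of X N))"
    using K(1) by blast
  fix P assume "is_proj X P \<and> S P \<and> (\<forall>P'. is_proj X P' \<and> S P' \<longrightarrow> proj_le X P' P)"
  then have P: "is_proj X P" and *: "S P" "\<And>P'. is_proj X P' \<Longrightarrow> S P' \<Longrightarrow> proj_le X P' P" by blast+
  from *(2)[OF K(1) SK] *(1) have "img X P = img X (proj_of X N)"
    using S[OF P] K(2) by (simp add: proj_le_def)
  then show "P = proj_of X N" by (rule proj_eqI[OF P K(1)])
qed

lemma the_smallest_proj:
  assumes X: "finite X" and N: "subsp N" "N \<subseteq> vecs X"
    and S: "\<And>R. is_proj X R \<Longrightarrow> S R \<longleftrightarrow> N \<subseteq> img X R"
  shows "(THE R. is_proj X R \<and> S R \<and> (\<forall>R'. is_proj X R' \<and> S R' \<longrightarrow> proj_le X R R')) = proj_of X N"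
proof (rule the_equality)
  note K = proj_of_props[OF X N]
  have SK: "S (proj_of X N)" using K by (simp add: S)
  moreover have "proj_le X (proj_of X N) P'" if "is_proj X P'" "S P'" for P'
    using that S[OF that(1)] K(2) by (simp add: proj_le_def)
  ultimately show "is_proj X (proj_of X N) \<and> S (proj_of X N) \<and>
      (\<forall>P'. is_proj X P' \<and> S P' \<longrightarrow> proj_le X (proj_of X N) P')"
    using K(1) by blast
  fix P assume "is_proj X P \<and> S P \<and> (\<forall>P'. is_proj X P' \<and> S P' \<longrightarrow> proj_le X P P')"
  then have P: "is_proj X P" and *: "S P" "\<And>P'. is_proj X P' \<Longrightarrow> S P' \<Longrightarrow> proj_le X P P'" by blast+
  from *(2)[OF K(1) SK] *(1) have "img X P = img X (proj_of X N)"
    using S[OF P] K(2) by (simp add: proj_le_def)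
  then show "P = proj_of X N" by (rule proj_eqI[OF P K(1)])
qed

definition out_cols :: "sop \<Rightarrow> vec set \<Rightarrow> vec set" where
  "out_cols F M = {(\<lambda>h. F (outer \<psi> \<psi>) h g) |\<psi> g. \<psi> \<in> M}"

context
  fixes V U Y :: "nat set" and E :: sop and Q :: op
  assumes fin: "finite V" "finite U" and E: "E \<in> DProg V" and Q: "is_proj U Q" and Y: "Y = V \<union> U"
begin

lemma ext_system:
  shows finite_Y: "finite Y" and prog_Y: "sop_ext V Y E \<in> DProg Y" and proj_Y: "is_proj Y (ext U Y Q)"
  using fin E Q unfolding Y by (auto intro!: DProg_sop_ext is_proj_ext)

lemma wp_props:
  shows is_proj_wp: "is_proj Y (wp V E U Q)"
    and img_wp: "img Y (wp V E U Q) = tot_space Y (sop_ext V Y E) (ext U Y Q)"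
proof -
  note N = subsp_tot_space[OF ext_system] tot_space_vecs[OF ext_system]
  have "wp V E U Q = proj_of Y (tot_space Y (sop_ext V Y E) (ext U Y Q))"
    unfolding wp_def Y[symmetric]
  proof (rule the_largest_proj[OF finite_Y N])
    fix P assume P: "is_proj Y P"
    show "sat_tot V E Y P U Q \<longleftrightarrow> img Y P \<subseteq> tot_space Y (sop_ext V Y E) (ext U Y Q)"
      using sat_tot_iff[OF fin(1) finite_Y fin(2) E P Q, of Y] P Y
      by (auto simp: ext_self is_projD)
  qed
  with proj_of_props[OF finite_Y N] show "is_proj Y (wp V E U Q)"
    "img Y (wp V E U Q) = tot_space Y (sop_ext V Y E) (ext U Y Q)" by simp_all
qed

lemma wlp_props:
  shows is_proj_wlp: "is_proj Y (wlp V E U Q)"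
    and img_wlp: "img Y (wlp V E U Q) = par_space Y (sop_ext V Y E) (ext U Y Q)"
proof -
  note N = subsp_par_space[OF ext_system] par_space_vecs[OF ext_system]
  have "wlp V E U Q = proj_of Y (par_space Y (sop_ext V Y E) (ext U Y Q))"
    unfolding wlp_def Y[symmetric]
  proof (rule the_largest_proj[OF finite_Y N])
    fix P assume P: "is_proj Y P"
    show "sat_par V E Y P U Q \<longleftrightarrow> img Y P \<subseteq> par_space Y (sop_ext V Y E) (ext U Y Q)"
      using sat_par_iff[OF fin(1) finite_Y fin(2) E P Q, of Y] P Y
      by (auto simp: ext_self is_projD)
  qed
  with proj_of_props[OF finite_Y N] show "is_proj Y (wlp V E U Q)"
    "img Y (wlp V E U Q) = par_space Y (sop_ext V Y E) (ext U Y Q)" by simp_all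
qed

text \<open>\<open>R\<close> fixes an output exactly when its columns lie in the image of
  \<open>R\<close>, and a subspace contains a span as soon as it contains the generators.\<close>

lemma out_cols_subset_iff:
  assumes R: "is_proj Y R"
  shows "vspan (out_cols (sop_ext V Y E) (img Y (ext U Y Q))) \<subseteq> img Y R \<longleftrightarrow>
    img Y (ext U Y Q) \<subseteq> par_space Y (sop_ext V Y E) R"
proof -
  let ?C = "out_cols (sop_ext V Y E) (img Y (ext U Y Q))"
  have "vspan ?C \<subseteq> img Y R \<longleftrightarrow> ?C \<subseteq> img Y R"
    using vspan_least[OF subsp_img] vspan_superset by blast
  also have "\<dots> \<longleftrightarrow> img Y (ext U Y Q) \<subseteq> par_space Y (sop_ext V Y E) R"
    by (auto simp: out_cols_def subset_iff par_space_iff_cols[OF finite_Y prog_Y R] img_imp_vecs)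
  finally show ?thesis .
qed

lemma sp_props:
  shows is_proj_sp: "is_proj Y (sp V E U Q)"
    and img_sp: "img Y (sp V E U Q) = vspan (out_cols (sop_ext V Y E) (img Y (ext U Y Q)))"
proof -
  let ?N = "vspan (out_cols (sop_ext V Y E) (img Y (ext U Y Q)))"
  have "out_cols (sop_ext V Y E) (img Y (ext U Y Q)) \<subseteq> vecs Y"
    by (auto simp: out_cols_def vecs_def is_opD(1)[OF is_op_sop_ext])
  note N = subsp_vspan vspan_least[OF subsp_vecs this]
  have "sp V E U Q = proj_of Y ?N"
    unfolding sp_def Y[symmetric]
  proof (rule the_smallest_proj[OF finite_Y N])
    fix R assume R: "is_proj Y R"
    show "sat_par V E U Q Y R \<longleftrightarrow> ?N \<subseteq> img Y R"
      unfolding out_cols_subset_iff[OF R]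
      using sat_par_iff[OF fin finite_Y E Q R, of Y] R Y
      by (auto simp: ext_self is_projD)
  qed
  with proj_of_props[OF finite_Y N] show "is_proj Y (sp V E U Q)"
    "img Y (sp V E U Q) = ?N" by simp_all
qed

text \<open>The Galois connection between strongest postcondition and weakest liberal precondition.
  Upper bounds for \<open>sp\<close> are derived from it, without a return to the columns.\<close>

lemma sp_le_iff:
  assumes "is_proj Y R"
  shows "img Y (sp V E U Q) \<subseteq> img Y R \<longleftrightarrow> img Y (ext U Y Q) \<subseteq> par_space Y (sop_ext V Y E) R"
  unfolding img_sp by (rule out_cols_subset_iff[OF assms])

end

subsection \<open>Adding an ancillary register\<close>

text \<open>The representing operator kills \<open>\<psi>\<close>, so the effect vanishes even on
  operators that are not positive, provided that one factor is \<open>\<psi>\<close>.\<close>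

lemma null_space_cross:
  assumes "finite X" "effect X \<delta>" "\<psi> \<in> null_space X \<delta>" "\<phi> \<in> vecs X"
  shows "\<delta> (outer \<phi> \<psi>) = 0"
proof -
  obtain D where D: "positive X D"
    and s: "\<And>u v. u \<in> vecs X \<Longrightarrow> v \<in> vecs X \<Longrightarrow> \<delta> (outer u v) = sesq X D v u"
    using effect_repr[OF assms(1,2)] by metis
  have v: "\<psi> \<in> vecs X" and "\<delta> (outer \<psi> \<psi>) = 0" using assms(3) by (simp_all add: null_space_def)
  then have "sesq X D \<psi> \<psi> = 0" using s[OF v v] by simp
  with positive_sesq_null[OF D this, of \<phi>] s[OF assms(4) v] show ?thesis by simp
qed

text \<open>For nonzero \<open>\<psi>\<close>, some column of the rank-one operator is a nonzero
  multiple of \<open>\<psi>\<close>.\<close>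

lemma fixes_outer_imp_img:
  assumes "is_proj X P" "\<psi> \<in> vecs X" "mult X P (outer \<psi> \<psi>) = outer \<psi> \<psi>"
  shows "\<psi> \<in> img X P"
proof (cases "\<psi> = (\<lambda>_. 0)")
  case True
  then show ?thesis using subspD(1)[OF subsp_img] by simp
next
  case False
  then obtain g where g: "\<psi> g \<noteq> 0" by (auto simp: fun_eq_iff)
  have "(\<lambda>h. outer \<psi> \<psi> h g) \<in> img X P" using assms by (simp add: proj_fixes_iff)
  from subspD(3)[OF subsp_img this, of "1 / cnj (\<psi> g)"] g show ?thesis by (simp add: outer_def)
qed

context
  fixes Y Z X :: "nat set" and F G :: sop and R :: op
  assumes fin: "finite Y" "finite Z" and disj: "Y \<inter> Z = {}" and X: "X = Y \<union> Z"
    and F: "F \<in> DProg Y" and G: "G = sop_ext Y X F" and R: "is_proj Z R"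
begin

lemma finite_X: "finite X" and Y_sub: "Y \<subseteq> X" and Z_sub: "Z \<subseteq> X"
  and X_minus: "X - Y = Z" "X - Z = Y"
  using fin disj by (auto simp: X)

lemma prog_G: "G \<in> DProg X"
  unfolding G by (rule DProg_sop_ext[OF F Y_sub finite_X])

lemma proj_R: "is_proj X (ext Z X R)"
  by (rule is_proj_ext[OF Z_sub finite_X R])

lemma merge_swap: "u \<in> states Y \<Longrightarrow> a \<in> states Z \<Longrightarrow> merge Y u a = merge Z a u"
  using disj by (force simp: merge_def states_def)

lemma block_mult_ext_ancilla:
  assumes "a \<in> states Z"
  shows "block Y (mult X (ext Z X R) \<rho>) a b = (\<lambda>u v. \<Sum>c\<in>states Z. R a c * block Y \<rho> c b u v)"
proof (rule op_eqI[of Y])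
  fix u v assume uv: "u \<in> states Y" "v \<in> states Y"
  have "block Y (mult X (ext Z X R) \<rho>) a b u v = mult X (ext Z X R) \<rho> (merge Z a u) (merge Y v b)"
    using uv assms by (simp add: block_def merge_swap)
  also have "\<dots> = (\<Sum>c\<in>states Z. R a c * \<rho> (merge Z c u) (merge Y v b))"
    unfolding mult_def using sum_ext[OF Z_sub finite_X assms] uv by (simp add: X_minus)
  also have "\<dots> = (\<Sum>c\<in>states Z. R a c * block Y \<rho> c b u v)"
    using uv by (simp add: block_def merge_swap)
  finally show "block Y (mult X (ext Z X R) \<rho>) a b u v = (\<Sum>c\<in>states Z. R a c * block Y \<rho> c b u v)" .
qed (auto intro!: is_op_sum is_op_scale)

text \<open>Left multiplication by \<open>I \<otimes> R\<close> forms linear combinations of blocks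
  along the ancilla, while \<open>G\<close> applies the linear map \<open>F\<close> inside each
  block.\<close>

lemma mult_ext_ancilla_commute: "mult X (ext Z X R) (G \<rho>) = G (mult X (ext Z X R) \<rho>)"
proof (rule op_eqI[of X])
  fix f g assume fg: "f \<in> states X" "g \<in> states X"
  let ?a = "restr Z f" and ?b = "restr Z g" and ?u = "restr Y f" and ?v = "restr Y g"
  have f: "f = merge Z ?a ?u" using merge_restr_Diff[OF Z_sub fg(1)] by (simp add: X_minus)
  have "mult X (ext Z X R) (G \<rho>) f g = (\<Sum>c\<in>states Z. R ?a c * G \<rho> (merge Z c ?u) g)"
    unfolding mult_def using sum_ext[OF Z_sub finite_X, of ?a ?u R "\<lambda>h. G \<rho> h g"] f
    by (simp add: X_minus)
  also have "\<dots> = (\<Sum>c\<in>states Z. R ?a c * F (block Y \<rho> c ?b) ?u ?v)"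
  proof (intro sum.cong refl)
    fix c assume c: "c \<in> states Z"
    have "merge Z c ?u \<in> states X" using merge_in_Diff[OF Z_sub c] by (simp add: X_minus)
    moreover have "restr Y (merge Z c ?u) = ?u" using disj by (intro restr_merge2) auto
    ultimately show "R ?a c * G \<rho> (merge Z c ?u) g = R ?a c * F (block Y \<rho> c ?b) ?u ?v"
      using c fg by (simp add: G sop_ext_def X_minus)
  qed
  also have "\<dots> = F (\<lambda>u v. \<Sum>c\<in>states Z. R ?a c * block Y \<rho> c ?b u v) ?u ?v"
    using lin_on_sum[OF DProg_lin_on[OF F], of "states Z" "\<lambda>c u v. R ?a c * block Y \<rho> c ?b u v" ?u ?v] fin
    by (simp add: is_op_scale DProgD(3)[OF F])
  also have "\<dots> = G (mult X (ext Z X R) \<rho>) f g"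
    using fg by (simp add: G sop_ext_def X_minus block_mult_ext_ancilla)
  finally show "mult X (ext Z X R) (G \<rho>) f g = G (mult X (ext Z X R) \<rho>) f g" .
qed (auto simp: G is_op_ext[OF Z_sub])

lemma block_G_outer:
  "a \<in> states Z \<Longrightarrow> b \<in> states Z \<Longrightarrow> block Y (G (outer \<phi> \<psi>)) a b = F (outer (slice Y \<phi> a) (slice Y \<psi> b))"
  unfolding G using block_sop_ext[OF DProgD(1)[OF F] Y_sub, where a = a and b = b]
  by (simp add: X_minus block_outer)

lemma trace_G_outer: "trace X (G (outer \<psi> \<psi>)) = (\<Sum>a\<in>states Z. trace Y (F (outer (slice Y \<psi> a) (slice Y \<psi> a))))"
  using trace_blocks[OF Y_sub, of "G (outer \<psi> \<psi>)"] by (simp add: X_minus block_G_outer)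

lemma trace_outer_slices: "trace X (outer \<psi> \<psi>) = (\<Sum>a\<in>states Z. trace Y (outer (slice Y \<psi> a) (slice Y \<psi> a)))"
  using trace_blocks[OF Y_sub, of "outer \<psi> \<psi>"] by (simp add: X_minus block_outer)

text \<open>From right to left there is a gap: the slices govern only the diagonal blocks of the
  output, but the equation to prove concerns all blocks. Positivity of the output closes it, as
  equality of traces suffices.\<close>

lemma par_space_ext_iff:
  assumes Q: "is_proj Y Q" and \<psi>: "\<psi> \<in> vecs X"
  shows "\<psi> \<in> par_space X G (ext Y X Q) \<longleftrightarrow> (\<forall>a\<in>states Z. slice Y \<psi> a \<in> par_space Y F Q)"
proof
  note b = block_mult_ext[OF Y_sub finite_X is_projD(1)[OF Q], unfolded X_minus]
  {
    assume "\<psi> \<in> par_space X G (ext Y X Q)"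
    then have "mult X (ext Y X Q) (G (outer \<psi> \<psi>)) = G (outer \<psi> \<psi>)" by (simp add: par_space_def)
    then show "\<forall>a\<in>states Z. slice Y \<psi> a \<in> par_space Y F Q"
      using b[of _ "G (outer \<psi> \<psi>)"] by (auto simp: par_space_def simp flip: block_G_outer)
  next
    assume *: "\<forall>a\<in>states Z. slice Y \<psi> a \<in> par_space Y F Q"
    have "trace X (mult X (ext Y X Q) (G (outer \<psi> \<psi>))) = trace X (G (outer \<psi> \<psi>))"
      unfolding trace_blocks[OF Y_sub] X_minus
      using * by (intro sum.cong refl) (simp add: b block_G_outer par_space_def)
    then have "mult X (ext Y X Q) (G (outer \<psi> \<psi>)) = G (outer \<psi> \<psi>)"
      using trace_proj_eq_iff[OF finite_X is_proj_ext[OF Y_sub finite_X Q]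
          DProg_positive[OF prog_G finite_X positive_outer[OF \<psi>]]] by simp
    with \<psi> show "\<psi> \<in> par_space X G (ext Y X Q)" by (simp add: par_space_def)
  }
qed

lemma par_space_tensor:
  assumes "is_proj Y Q"
  shows "par_space X G (tensor Y Z Q R) = par_space X G (ext Y X Q) \<inter> par_space X G (ext Z X R)"
  using tensor_fixes_iff[OF disj fin assms R] by (auto simp: par_space_def X)

text \<open>\<open>I \<otimes> R\<close> passes through \<open>G\<close> and is absorbed by
  \<open>\<psi>\<close>. The reverse inclusion fails in general, for instance for the zero program;
  this is the source of the one-sided law for \<open>wlp\<close>.\<close>

lemma img_ancilla_in_par_space: "img X (ext Z X R) \<subseteq> par_space X G (ext Z X R)"
proof
  fix \<psi> assume "\<psi> \<in> img X (ext Z X R)"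
  then have \<psi>: "\<psi> \<in> vecs X" "apply_op X (ext Z X R) \<psi> = \<psi>" by (auto simp: img_proj[OF proj_R])
  then show "\<psi> \<in> par_space X G (ext Z X R)"
    by (simp add: par_space_def mult_ext_ancilla_commute mult_outer is_projD[OF proj_R])
qed

text \<open>\<open>A\<close> and \<open>Q\<close> are independent so that two laws are served:
  \<open>A\<close> is a weakest liberal precondition of \<open>Q\<close> in one, and
  \<open>Q\<close> is a strongest postcondition of \<open>A\<close> in the other.\<close>

lemma img_tensor_subset_par_space:
  assumes A: "is_proj Y A" and Q: "is_proj Y Q" and AQ: "img Y A \<subseteq> par_space Y F Q"
  shows "img X (tensor Y Z A R) \<subseteq> par_space X G (tensor Y Z Q R)"
proof
  fix \<psi> assume "\<psi> \<in> img X (tensor Y Z A R)"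
  then have \<psi>: "\<psi> \<in> img X (ext Y X A)" "\<psi> \<in> img X (ext Z X R)"
    using img_tensor[OF disj fin A R] by (auto simp: X)
  have v: "\<psi> \<in> vecs X" using \<psi>(1) by (rule img_imp_vecs)
  have "\<forall>a\<in>states Z. slice Y \<psi> a \<in> par_space Y F Q"
    using \<psi>(1) AQ by (auto simp: img_ext_iff[OF Y_sub finite_X A v] X_minus)
  then show "\<psi> \<in> par_space X G (tensor Y Z Q R)"
    using \<psi>(2) img_ancilla_in_par_space v by (auto simp: par_space_tensor[OF Q] par_space_ext_iff[OF Q])
qed

text \<open>Trace preservation recovers the reverse inclusion. For \<open>\<phi>\<close>, the
  component of \<open>\<psi>\<close> outside \<open>R\<close>, the total effect at
  \<open>outer \<phi> \<psi>\<close> is zero, as \<open>\<psi>\<close> is a null vector. Its part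
  that involves \<open>R\<close> is zero as well, because \<open>R\<close> passes through
  \<open>G\<close> and kills \<open>\<phi>\<close>. What is left is the trace of
  \<open>outer \<phi> \<psi>\<close>, the squared norm of \<open>\<phi>\<close>.\<close>

lemma tot_space_ancilla: "tot_space X G (ext Z X R) \<subseteq> img X (ext Z X R)"
proof
  fix \<psi> assume \<psi>: "\<psi> \<in> tot_space X G (ext Z X R)"
  then have v: "\<psi> \<in> vecs X" by (auto simp: tot_space_def par_space_def)
  let ?C = "compl_op X (ext Z X R)" and ?\<rho> = "outer \<psi> \<psi>"
  note C = is_proj_compl[OF finite_X proj_R]
  define \<phi> where "\<phi> = apply_op X ?C \<psi>"
  have C\<rho>: "mult X ?C ?\<rho> = outer \<phi> \<psi>" by (simp add: \<phi>_def mult_outer is_projD[OF C])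
  have "mult X (ext Z X R) ?C = zero_op"
    using finite_X by (simp add: mult_compl_right is_projD[OF proj_R] zero_op_def)
  then have "mult X (ext Z X R) (outer \<phi> \<psi>) = zero_op"
    by (simp flip: C\<rho> mult_assoc) (simp add: mult_def zero_op_def)
  then have "mult X (ext Z X R) (G (outer \<phi> \<psi>)) = zero_op"
    by (simp add: mult_ext_ancilla_commute DProg_zero[OF prog_G])
  moreover have "tot_eff X G (ext Z X R) (outer \<phi> \<psi>) = 0"
    using \<psi> by (intro null_space_cross[OF finite_X effect_tot_eff[OF finite_X prog_G proj_R]])
      (simp_all add: null_space_tot_eff[OF finite_X prog_G proj_R] \<phi>_def)
  ultimately have "trace X (mult X ?C ?\<rho>) = 0"
    by (simp add: tot_eff_def C\<rho>) (simp add: trace_def zero_op_def)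
  then have "trace X (mult X (ext Z X R) ?\<rho>) = trace X ?\<rho>"
    using v by (simp add: trace_compl_mult finite_X)
  then have eq: "mult X (ext Z X R) ?\<rho> = ?\<rho>"
    using trace_proj_eq_iff[OF finite_X proj_R positive_outer[OF v]] by simp
  show "\<psi> \<in> img X (ext Z X R)" by (rule fixes_outer_imp_img[OF proj_R v eq])
qed

lemma tot_space_tensor:
  assumes A: "is_proj Y A" and Q: "is_proj Y Q" and AQ: "img Y A = tot_space Y F Q"
  shows "tot_space X G (tensor Y Z Q R) = img X (tensor Y Z A R)"
proof (intro equalityI subsetI)
  fix \<psi> assume \<psi>: "\<psi> \<in> img X (tensor Y Z A R)"
  then have "\<psi> \<in> img X (ext Y X A)"
    using img_tensor[OF disj fin A R] by (auto simp: X)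
  moreover have v: "\<psi> \<in> vecs X" using \<psi> by (rule img_imp_vecs)
  ultimately have "\<forall>a\<in>states Z. slice Y \<psi> a \<in> tot_space Y F Q"
    by (simp add: img_ext_iff[OF Y_sub finite_X A v] X_minus AQ)
  then have "trace X (G (outer \<psi> \<psi>)) = trace X (outer \<psi> \<psi>)"
    unfolding trace_G_outer trace_outer_slices by (intro sum.cong refl) (simp add: tot_space_def)
  moreover have "\<psi> \<in> par_space X G (tensor Y Z Q R)"
    using img_tensor_subset_par_space[OF A Q] \<psi> AQ by (auto simp: tot_space_def)
  ultimately show "\<psi> \<in> tot_space X G (tensor Y Z Q R)" by (simp add: tot_space_def)
next
  fix \<psi> assume "\<psi> \<in> tot_space X G (tensor Y Z Q R)"
  then have p: "\<psi> \<in> par_space X G (ext Y X Q)" "\<psi> \<in> par_space X G (ext Z X R)"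
    and t: "trace X (G (outer \<psi> \<psi>)) = trace X (outer \<psi> \<psi>)"
    by (auto simp: tot_space_def par_space_tensor[OF Q])
  have v: "\<psi> \<in> vecs X" using p by (simp add: par_space_def)
  let ?o = "\<lambda>a. outer (slice Y \<psi> a) (slice Y \<psi> a)"
  \<comment> \<open>No slice can gain trace, so preservation of the total forces preservation on
    every slice.\<close>
  have "(\<Sum>a\<in>states Z. trace Y (?o a) - trace Y (F (?o a))) = 0"
    using t unfolding trace_G_outer trace_outer_slices by (simp add: sum_subtractf)
  moreover have "0 \<le> trace Y (?o a) - trace Y (F (?o a))" for a
    using DProgD(5)[OF F positive_outer[OF slice_in_vecs]] by simp
  ultimately have "\<forall>a\<in>states Z. trace Y (?o a) - trace Y (F (?o a)) = 0"
    using fin by (subst (asm) sum_nonneg_eq_0_iff) auto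
  then have "\<forall>a\<in>states Z. slice Y \<psi> a \<in> img Y A"
    using p(1) by (simp add: par_space_ext_iff[OF Q v] AQ tot_space_def)
  then have "\<psi> \<in> img X (ext Y X A)"
    by (simp add: img_ext_iff[OF Y_sub finite_X A v] X_minus)
  moreover have "\<psi> \<in> img X (ext Z X R)"
    using p(2) t tot_space_ancilla by (auto simp: tot_space_def)
  ultimately show "\<psi> \<in> img X (tensor Y Z A R)"
    using img_tensor[OF disj fin A R] by (simp add: X)
qed

text \<open>A column of \<open>F (\<psi>\<psi>\<^sup>\<dagger>) \<otimes>
  \<beta>\<beta>\<^sup>\<dagger>\<close>: a column of the left factor times \<open>\<beta>\<close>,
  scaled by the conjugate entry of \<open>\<beta>\<close>.\<close>

lemma col_G_tvec:
  assumes \<psi>: "\<psi> \<in> vecs Y" and yb: "y \<in> states Y" "b \<in> states Z"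
  shows "(\<lambda>f. G (outer (tvec Y Z \<psi> \<beta>) (tvec Y Z \<psi> \<beta>)) f (merge Y y b))
    = (\<lambda>f. cnj (\<beta> b) * tvec Y Z (\<lambda>h. F (outer \<psi> \<psi>) h y) \<beta> f)"
proof
  fix f
  have slice: "slice Y (tvec Y Z \<psi> \<beta>) a = (\<lambda>u. \<beta> a * \<psi> u)" if "a \<in> states Z" for a
    using that \<psi> disj by (intro ext) (simp add: slice_def tvec_def merge_in restr_merge2 vecs_def)
  show "G (outer (tvec Y Z \<psi> \<beta>) (tvec Y Z \<psi> \<beta>)) f (merge Y y b)
      = cnj (\<beta> b) * tvec Y Z (\<lambda>h. F (outer \<psi> \<psi>) h y) \<beta> f"
  proof (cases "f \<in> states X")
    case True
    let ?a = "restr Z f"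
    have g: "merge Y y b \<in> states X" "restr Z (merge Y y b) = b"
      using yb merge_in disj by (auto simp: X restr_merge2)
    have "block Y (outer (tvec Y Z \<psi> \<beta>) (tvec Y Z \<psi> \<beta>)) ?a b
        = (\<lambda>u v. (\<beta> ?a * cnj (\<beta> b)) * outer \<psi> \<psi> u v)"
      using yb by (simp add: block_outer slice) (simp add: outer_def mult_ac)
    then have "G (outer (tvec Y Z \<psi> \<beta>) (tvec Y Z \<psi> \<beta>)) f (merge Y y b)
        = (\<beta> ?a * cnj (\<beta> b)) * F (outer \<psi> \<psi>) (restr Y f) y"
      using True g yb \<psi> by (simp add: G sop_ext_def X_minus DProgD(3)[OF F])
    then show ?thesis using True by (simp add: tvec_def X)
  qed (simp add: G sop_ext_def tvec_def X)
qed

text \<open>The lower bound for \<open>sp\<close> of a product. Outputs of product vectors have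
  product columns, so every generator of the image of \<open>A\<close>, tensored with a vector of
  \<open>R\<close>, already lies in any valid postcondition \<open>T\<close>.\<close>

lemma out_cols_tensor:
  assumes P: "is_proj Y P" and A: "is_proj Y A" "img Y A = vspan (out_cols F (img Y P))"
    and T: "is_proj X T" "img X (tensor Y Z P R) \<subseteq> par_space X G T"
  shows "img X (tensor Y Z A R) \<subseteq> img X T"
  unfolding X
proof (rule img_tensor_subset[OF fin A(1) R subsp_img])
  fix \<alpha> \<beta> assume "\<alpha> \<in> img Y A" and \<beta>: "\<beta> \<in> img Z R"
  let ?N = "{\<alpha>. tvec Y Z \<alpha> \<beta> \<in> img (Y \<union> Z) T}"
  have "out_cols F (img Y P) \<subseteq> ?N"
  proof
    fix \<alpha> assume "\<alpha> \<in> out_cols F (img Y P)"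
    then obtain \<psi> y where \<psi>: "\<psi> \<in> img Y P" and \<alpha>: "\<alpha> = (\<lambda>h. F (outer \<psi> \<psi>) h y)"
      by (auto simp: out_cols_def)
    have v: "\<psi> \<in> vecs Y" using \<psi> by (rule img_imp_vecs)
    have zero: "(\<lambda>_. 0) \<in> img X T" by (rule subspD(1)[OF subsp_img])
    \<comment> \<open>In the first two cases the product vector is zero; in the last, the nonzero
      entry of \<open>\<beta>\<close> is divided out of the column.\<close>
    consider "y \<notin> states Y" | "\<beta> = (\<lambda>_. 0)" | b where "y \<in> states Y" "\<beta> b \<noteq> 0" by (auto simp: fun_eq_iff)
    then have "tvec Y Z \<alpha> \<beta> \<in> img X T"
    proof cases
      case 1
      then have "\<alpha> h = 0" for h using is_opD(2)[OF DProgD(1)[OF F is_op_outer[OF v v]]] \<alpha> by simp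
      then have "tvec Y Z \<alpha> \<beta> = (\<lambda>_. 0)" by (intro ext) (simp add: tvec_def)
      with zero show ?thesis by simp
    next
      case 2
      then have "tvec Y Z \<alpha> \<beta> = (\<lambda>_. 0)" by (intro ext) (simp add: tvec_def)
      with zero show ?thesis by simp
    next
      case (3 b)
      have b: "b \<in> states Z" using 3 img_imp_vecs[OF \<beta>] by (auto simp: vecs_def)
      have "tvec Y Z \<psi> \<beta> \<in> par_space X G T"
        using tvec_in_img_tensor[OF disj P R \<psi> \<beta>] T(2) by (auto simp: X)
      then have "(\<lambda>f. G (outer (tvec Y Z \<psi> \<beta>) (tvec Y Z \<psi> \<beta>)) f (merge Y y b)) \<in> img X T"
        by (simp add: par_space_iff_cols[OF finite_X prog_G T(1)])
      then have "(\<lambda>f. cnj (\<beta> b) * tvec Y Z \<alpha> \<beta> f) \<in> img X T"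
        by (simp add: col_G_tvec[OF v 3(1) b] \<alpha>)
      from subspD(3)[OF subsp_img this, of "1 / cnj (\<beta> b)"] 3 show ?thesis by simp
    qed
    then show "\<alpha> \<in> ?N" by (simp add: X)
  qed
  then have "img Y A \<subseteq> ?N"
    unfolding A(2) by (intro vspan_least subsp_tvec_left subsp_img)
  with \<open>\<alpha> \<in> img Y A\<close> show "tvec Y Z \<alpha> \<beta> \<in> img (Y \<union> Z) T" by auto
qed

end

lemma ext_tensor:
  assumes "W' \<inter> (V \<union> W) = {}"
  shows "ext (W \<union> W') (V \<union> W \<union> W') (tensor W W' Q R) = tensor (V \<union> W) W' (ext W (V \<union> W) Q) R"
proof (rule op_eqI[of "V \<union> W \<union> W'"])
  have s: "W \<union> W' \<union> (V \<union> W \<union> W' - (W \<union> W')) = V \<union> W \<union> W'" "V \<union> W \<union> W' - (W \<union> W') = V \<union> W - W"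
    "W \<union> W' \<union> (V \<union> W - W) = V \<union> W \<union> W'" "W \<union> (V \<union> W - W) = V \<union> W" "W \<inter> (W \<union> W') = W" "W' \<inter> (W \<union> W') = W'"
    "W \<inter> (V \<union> W) = W" "(V \<union> W - W) \<inter> (V \<union> W) = V \<union> W - W" using assms by auto
  fix f g assume "f \<in> states (V \<union> W \<union> W')" "g \<in> states (V \<union> W \<union> W')"
  then show "ext (W \<union> W') (V \<union> W \<union> W') (tensor W W' Q R) f g = tensor (V \<union> W) W' (ext W (V \<union> W) Q) R f g"
    unfolding ext_def tensor_def s by (simp add: restr_restr s mult_ac del: Un_Diff_cancel)
qed (auto intro!: is_op_ext)

subsection \<open>Lattice structure\<close>

lemma par_space_mono:
  assumes "finite X" "F \<in> DProg X" "is_proj X P" "is_proj X Q" "img X P \<subseteq> img X Q"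
  shows "par_space X F P \<subseteq> par_space X F Q"
proof
  fix \<psi> assume "\<psi> \<in> par_space X F P"
  then show "\<psi> \<in> par_space X F Q"
    unfolding par_space_iff_cols[OF assms(1-3)] par_space_iff_cols[OF assms(1,2,4)]
    using subsetD[OF assms(5)] by simp
qed

lemma img_ext_meet:
  assumes "U \<subseteq> X" "finite X" "is_proj U P" "is_proj U Q"
  shows "img X (ext U X (proj_meet U P Q)) = img X (ext U X P) \<inter> img X (ext U X Q)"
proof -
  have "finite U" using assms finite_subset by blast
  note M = proj_meet_props[OF this, of P Q]
  have "\<psi> \<in> img X (ext U X (proj_meet U P Q)) \<longleftrightarrow> \<psi> \<in> img X (ext U X P) \<inter> img X (ext U X Q)"
    if "\<psi> \<in> vecs X" for \<psi>
    using img_ext_iff[OF assms(1,2) M(1) that] img_ext_iff[OF assms(1,2,3) that]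
      img_ext_iff[OF assms(1,2,4) that] unfolding M(2) by blast
  then show ?thesis using img_imp_vecs by blast
qed

text \<open>An arbitrary \<open>N\<close> cannot be tested slice by slice, so product vectors are
  used: with the right factor fixed, the condition is linear in the left one and passes to the
  span.\<close>

lemma img_ext_join_subset:
  assumes "U \<subseteq> X" "finite X" "is_proj U P" "is_proj U Q" and N: "subsp N"
    and PN: "img X (ext U X P) \<subseteq> N" and QN: "img X (ext U X Q) \<subseteq> N"
  shows "img X (ext U X (proj_join U P Q)) \<subseteq> N"
proof -
  have U: "finite U" using assms finite_subset by blast
  note J = proj_join_props[OF U, of P Q]
  let ?Z = "X - U"
  have X: "U \<union> ?Z = X" and Z: "finite ?Z" using assms by auto
  have d: "U \<inter> ?Z = {}" by auto
  have "img (U \<union> ?Z) (tensor U ?Z (proj_join U P Q) (id_op ?Z)) \<subseteq> N"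
  proof (rule img_tensor_subset[OF U Z J(1) is_proj_id[OF Z] N])
    fix \<alpha> \<beta> assume \<alpha>: "\<alpha> \<in> img U (proj_join U P Q)" and \<beta>: "\<beta> \<in> img ?Z (id_op ?Z)"
    have "tvec U ?Z u \<beta> \<in> N" if "u \<in> img U P" for u
      using tvec_in_img_tensor[OF d assms(3) is_proj_id[OF Z] that \<beta>, unfolded X] PN[unfolded ext_def] by (rule rev_subsetD)
    moreover have "tvec U ?Z u \<beta> \<in> N" if "u \<in> img U Q" for u
      using tvec_in_img_tensor[OF d assms(4) is_proj_id[OF Z] that \<beta>, unfolded X] QN[unfolded ext_def] by (rule rev_subsetD)
    ultimately have "img U P \<union> img U Q \<subseteq> {\<alpha>. tvec U ?Z \<alpha> \<beta> \<in> N}" by auto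
    then have "vspan (img U P \<union> img U Q) \<subseteq> {\<alpha>. tvec U ?Z \<alpha> \<beta> \<in> N}"
      by (intro vspan_least subsp_tvec_left N)
    with \<alpha> show "tvec U ?Z \<alpha> \<beta> \<in> N" unfolding J(2) by blast
  qed
  then show ?thesis unfolding X ext_def .
qed

section \<open>Laws for a single postcondition register\<close>

context
  fixes V W Y :: "nat set" and E :: sop
  assumes finV: "finite V" and finW: "finite W" and E: "E \<in> DProg V" and Y: "Y = V \<union> W"
begin

lemma W_sub: "W \<subseteq> Y" by (simp add: Y)

lemma transformers_mono:
  assumes "is_proj W P" "is_proj W Q" "proj_le W P Q"
  shows "img Y (wp V E W P) \<subseteq> img Y (wp V E W Q)" "img Y (wlp V E W P) \<subseteq> img Y (wlp V E W Q)"
    "img Y (sp V E W P) \<subseteq> img Y (sp V E W Q)"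
proof -
  note EP = ext_system[OF finV finW E assms(1) Y] and EQ = ext_system[OF finV finW E assms(2) Y]
  have le: "img Y (ext W Y P) \<subseteq> img Y (ext W Y Q)"
    by (rule ext_mono[OF W_sub EP(1) assms])
  have "par_space Y (sop_ext V Y E) (ext W Y P) \<subseteq> par_space Y (sop_ext V Y E) (ext W Y Q)"
    by (rule par_space_mono[OF EP EQ(3) le])
  then show "img Y (wp V E W P) \<subseteq> img Y (wp V E W Q)" "img Y (wlp V E W P) \<subseteq> img Y (wlp V E W Q)"
    unfolding img_wp[OF finV finW E assms(1) Y] img_wp[OF finV finW E assms(2) Y]
      img_wlp[OF finV finW E assms(1) Y] img_wlp[OF finV finW E assms(2) Y]
    by (auto simp: tot_space_def)
  note R = is_proj_sp[OF finV finW E assms(2) Y]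
  have "img Y (ext W Y Q) \<subseteq> par_space Y (sop_ext V Y E) (sp V E W Q)"
    using sp_le_iff[OF finV finW E assms(2) Y R] by simp
  with le show "img Y (sp V E W P) \<subseteq> img Y (sp V E W Q)"
    using sp_le_iff[OF finV finW E assms(1) Y R] by simp
qed

text \<open>The zero postcondition forces a zero output, and preservation of the trace then gives
  the input norm zero.\<close>

lemma wp_zero: "wp V E W zero_op = zero_op"
proof (rule proj_eqI[of Y])
  note Z = is_proj_zero[of W]
  note S = ext_system[OF finV finW E Z Y]
  show "is_proj Y (wp V E W zero_op)" by (rule is_proj_wp[OF finV finW E Z Y])
  have "\<psi> = (\<lambda>_. 0)" if "\<psi> \<in> tot_space Y (sop_ext V Y E) zero_op" for \<psi>
  proof -
    from that have v: "\<psi> \<in> vecs Y" and e: "mult Y zero_op (sop_ext V Y E (outer \<psi> \<psi>)) = sop_ext V Y E (outer \<psi> \<psi>)"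
      and t: "trace Y (sop_ext V Y E (outer \<psi> \<psi>)) = trace Y (outer \<psi> \<psi>)"
      by (auto simp: tot_space_def par_space_def)
    have "trace Y (outer \<psi> \<psi>) = 0"
      unfolding t[symmetric] by (subst e[symmetric]) (simp add: trace_def mult_def zero_op_def)
    then show ?thesis by (rule trace_outer_eq_0[OF S(1) v])
  qed
  then have "tot_space Y (sop_ext V Y E) zero_op \<subseteq> {\<lambda>_. 0}" by blast
  moreover have "(\<lambda>_. 0) \<in> tot_space Y (sop_ext V Y E) zero_op"
    by (rule subspD(1)[OF subsp_tot_space[OF S(1,2) is_proj_zero]])
  ultimately show "img Y (wp V E W zero_op) = img Y zero_op"
    unfolding img_wp[OF finV finW E Z Y] ext_zero by (auto simp: img_def)
qed (rule is_proj_zero)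

lemma sp_zero: "sp V E W zero_op = zero_op"
proof (rule proj_eqI[of Y])
  note Z = is_proj_zero[of W]
  note S = ext_system[OF finV finW E Z Y]
  show "is_proj Y (sp V E W zero_op)" by (rule is_proj_sp[OF finV finW E Z Y])
  have i: "img Y zero_op = {\<lambda>_. 0}" by (auto simp: img_def)
  have "img Y (ext W Y zero_op) \<subseteq> par_space Y (sop_ext V Y E) zero_op"
    using subspD(1)[OF subsp_par_space[OF S(1,2) is_proj_zero]] by (simp add: ext_zero i)
  then have "img Y (sp V E W zero_op) \<subseteq> img Y zero_op"
    using sp_le_iff[OF finV finW E Z Y is_proj_zero] by simp
  moreover have "(\<lambda>_. 0) \<in> img Y (sp V E W zero_op)" by (rule subspD(1)[OF subsp_img])
  ultimately show "img Y (sp V E W zero_op) = img Y zero_op" unfolding i by blast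
qed (rule is_proj_zero)

lemma wlp_id: "wlp V E W (id_op W) = ext W Y (id_op W)"
proof (rule proj_eqI[of Y])
  note I = is_proj_id[OF finW]
  note S = ext_system[OF finV finW E I Y]
  show "is_proj Y (wlp V E W (id_op W))" by (rule is_proj_wlp[OF finV finW E I Y])
  show "is_proj Y (ext W Y (id_op W))" by (rule S(3))
  have "img Y (id_op Y) = vecs Y"
    using S(1) by (auto simp: img_proj is_proj_id apply_op_id)
  moreover have "par_space Y (sop_ext V Y E) (id_op Y) = vecs Y"
    using S(1) by (auto simp: par_space_def mult_id_left)
  ultimately show "img Y (wlp V E W (id_op W)) = img Y (ext W Y (id_op W))"
    unfolding img_wlp[OF finV finW E I Y] ext_id[OF W_sub] by simp
qed

context
  fixes P Q :: op
  assumes P: "is_proj W P" and Q: "is_proj W Q"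
begin

lemma meet_le: "proj_le W (proj_meet W P Q) P" "proj_le W (proj_meet W P Q) Q"
  using proj_meet_props(2)[OF finW, of P Q] by (auto simp: proj_le_def)

lemma le_join: "proj_le W P (proj_join W P Q)" "proj_le W Q (proj_join W P Q)"
  using proj_join_props(2)[OF finW, of P Q] vspan_superset[of "img W P \<union> img W Q"]
  by (simp_all add: proj_le_def)

lemma par_space_meet:
  "par_space Y (sop_ext V Y E) (ext W Y (proj_meet W P Q)) =
    par_space Y (sop_ext V Y E) (ext W Y P) \<inter> par_space Y (sop_ext V Y E) (ext W Y Q)"
proof -
  note M = proj_meet_props(1)[OF finW, of P Q]
  note S = ext_system[OF finV finW E _ Y]
  show ?thesis
    by (auto simp: par_space_iff_cols[OF S[OF P]] par_space_iff_cols[OF S[OF Q]]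
        par_space_iff_cols[OF S[OF M]] img_ext_meet[OF W_sub S(1)[OF P] P Q])
qed

lemma wlp_meet: "wlp V E W (proj_meet W P Q) = proj_meet Y (wlp V E W P) (wlp V E W Q)"
  unfolding proj_meet_def[of Y]
  by (rule proj_of_eq[symmetric])
     (simp_all add: is_proj_wlp[OF finV finW E _ Y] img_wlp[OF finV finW E _ Y]
        proj_meet_props(1) finW P Q par_space_meet)

text \<open>The additional trace condition of \<open>tot_space\<close> does not mention the
  postcondition, so the meet law for \<open>par_space\<close> carries over.\<close>

lemma wp_meet: "wp V E W (proj_meet W P Q) = proj_meet Y (wp V E W P) (wp V E W Q)"
proof -
  have "tot_space Y (sop_ext V Y E) (ext W Y (proj_meet W P Q)) =
    tot_space Y (sop_ext V Y E) (ext W Y P) \<inter> tot_space Y (sop_ext V Y E) (ext W Y Q)"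
    by (auto simp: tot_space_def par_space_meet)
  then show ?thesis
    unfolding proj_meet_def[of Y]
    by (intro proj_of_eq[symmetric])
       (simp_all add: is_proj_wp[OF finV finW E _ Y] img_wp[OF finV finW E _ Y]
          proj_meet_props(1) finW P Q)
qed

lemma finite_base: "finite Y" using finV finW by (simp add: Y)

lemma sp_meet_le: "img Y (sp V E W (proj_meet W P Q)) \<subseteq> img Y (proj_meet Y (sp V E W P) (sp V E W Q))"
  unfolding proj_meet_props(2)[OF finite_base]
  using transformers_mono(3)[OF proj_meet_props(1)[OF finW] P meet_le(1)]
    transformers_mono(3)[OF proj_meet_props(1)[OF finW] Q meet_le(2)] by blast

lemma join_wp_le: "img Y (proj_join Y (wp V E W P) (wp V E W Q)) \<subseteq> img Y (wp V E W (proj_join W P Q))"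
  unfolding proj_join_props(2)[OF finite_base]
  using transformers_mono(1)[OF P proj_join_props(1)[OF finW] le_join(1)]
    transformers_mono(1)[OF Q proj_join_props(1)[OF finW] le_join(2)]
  by (intro vspan_least subsp_img) simp

lemma join_wlp_le: "img Y (proj_join Y (wlp V E W P) (wlp V E W Q)) \<subseteq> img Y (wlp V E W (proj_join W P Q))"
  unfolding proj_join_props(2)[OF finite_base]
  using transformers_mono(2)[OF P proj_join_props(1)[OF finW] le_join(1)]
    transformers_mono(2)[OF Q proj_join_props(1)[OF finW] le_join(2)]
  by (intro vspan_least subsp_img) simp

text \<open>A lower adjoint preserves joins: one inclusion is monotonicity, and the other is checked
  on \<open>P\<close> and \<open>Q\<close> separately after crossing the Galois connection.\<close>

lemma sp_join: "proj_join Y (sp V E W P) (sp V E W Q) = sp V E W (proj_join W P Q)"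
proof (rule proj_eqI[of Y])
  note J = proj_join_props(1)[OF finW, of P Q]
  let ?R = "proj_join Y (sp V E W P) (sp V E W Q)"
  note R = proj_join_props[OF finite_base, of "sp V E W P" "sp V E W Q"]
  show "is_proj Y ?R" by (rule R(1))
  show "is_proj Y (sp V E W (proj_join W P Q))" by (rule is_proj_sp[OF finV finW E J Y])
  have "img Y ?R \<subseteq> img Y (sp V E W (proj_join W P Q))"
    unfolding R(2) using transformers_mono(3)[OF P J le_join(1)] transformers_mono(3)[OF Q J le_join(2)]
    by (intro vspan_least subsp_img) simp
  moreover have "img Y (sp V E W (proj_join W P Q)) \<subseteq> img Y ?R"
    unfolding sp_le_iff[OF finV finW E J Y R(1)]
  proof (rule img_ext_join_subset[OF W_sub finite_base P Q])
    note S = ext_system[OF finV finW E P Y]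
    show "subsp (par_space Y (sop_ext V Y E) ?R)" by (rule subsp_par_space[OF S(1,2) R(1)])
    have "img Y (sp V E W P) \<union> img Y (sp V E W Q) \<subseteq> img Y ?R" unfolding R(2) by (rule vspan_superset)
    then show "img Y (ext W Y P) \<subseteq> par_space Y (sop_ext V Y E) ?R"
      "img Y (ext W Y Q) \<subseteq> par_space Y (sop_ext V Y E) ?R"
      using sp_le_iff[OF finV finW E P Y R(1)] sp_le_iff[OF finV finW E Q Y R(1)] by simp_all
  qed
  ultimately show "img Y ?R = img Y (sp V E W (proj_join W P Q))" by (rule equalityI)
qed

end

section \<open>Tensor laws for a disjoint register\<close>

context
  fixes W' :: "nat set" and Q R :: op
  assumes finW': "finite W'" and disj: "W' \<inter> (V \<union> W) = {}" and Q: "is_proj W Q" and R: "is_proj W' R"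
begin

lemma tensor_system:
  shows finite_YW': "finite Y" "finite W'" "Y \<inter> W' = {}"
    and proj_WW': "is_proj (W \<union> W') (tensor W W' Q R)"
    and finite_WW': "finite (W \<union> W')"
    and union_WW': "Y \<union> W' = V \<union> (W \<union> W')"
    and prog_YW': "sop_ext V (Y \<union> W') E = sop_ext Y (Y \<union> W') (sop_ext V Y E)"
    and ext_WW': "ext (W \<union> W') (Y \<union> W') (tensor W W' Q R) = tensor Y W' (ext W Y Q) R"
proof -
  show "finite Y" "finite W'" "Y \<inter> W' = {}" "finite (W \<union> W')" "Y \<union> W' = V \<union> (W \<union> W')"
    using finV finW finW' disj by (auto simp: Y)
  show "is_proj (W \<union> W') (tensor W W' Q R)" using disj by (intro is_proj_tensor Q R) auto
  show "sop_ext V (Y \<union> W') E = sop_ext Y (Y \<union> W') (sop_ext V Y E)"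
    by (rule ext, rule sop_ext_trans[symmetric]) (auto simp: Y)
  show "ext (W \<union> W') (Y \<union> W') (tensor W W' Q R) = tensor Y W' (ext W Y Q) R"
    unfolding Y by (rule ext_tensor[OF disj])
qed

lemma wp_tensor: "wp V E (W \<union> W') (tensor W W' Q R) = tensor Y W' (wp V E W Q) R"
proof (rule proj_eqI[of "Y \<union> W'"])
  note A = wp_props[OF finV finW E Q Y]
  show "is_proj (Y \<union> W') (wp V E (W \<union> W') (tensor W W' Q R))"
    by (rule is_proj_wp[OF finV finite_WW' E proj_WW' union_WW'])
  show "is_proj (Y \<union> W') (tensor Y W' (wp V E W Q) R)"
    by (rule is_proj_tensor[OF finite_YW'(3) A(1) R])
  show "img (Y \<union> W') (wp V E (W \<union> W') (tensor W W' Q R)) = img (Y \<union> W') (tensor Y W' (wp V E W Q) R)"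
    unfolding img_wp[OF finV finite_WW' E proj_WW' union_WW'] ext_WW'
    by (rule tot_space_tensor[OF finite_YW' refl prog_Y[OF finV finW E Q Y] prog_YW' R A(1)
          proj_Y[OF finV finW E Q Y] A(2)])
qed

lemma wlp_tensor:
  "img (Y \<union> W') (tensor Y W' (wlp V E W Q) R) \<subseteq> img (Y \<union> W') (wlp V E (W \<union> W') (tensor W W' Q R))"
  unfolding img_wlp[OF finV finite_WW' E proj_WW' union_WW'] ext_WW'
  by (rule img_tensor_subset_par_space[OF finite_YW' refl prog_Y[OF finV finW E Q Y] prog_YW' R
        is_proj_wlp[OF finV finW E Q Y] proj_Y[OF finV finW E Q Y]])
     (simp add: img_wlp[OF finV finW E Q Y])

lemma sp_tensor: "sp V E (W \<union> W') (tensor W W' Q R) = tensor Y W' (sp V E W Q) R"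
proof (rule proj_eqI[of "Y \<union> W'"])
  note A = sp_props[OF finV finW E Q Y]
  note S = ext_system[OF finV finW E Q Y]
  note T = is_proj_sp[OF finV finite_WW' E proj_WW' union_WW']
  note AR = is_proj_tensor[OF finite_YW'(3) A(1) R]
  show "is_proj (Y \<union> W') (sp V E (W \<union> W') (tensor W W' Q R))" by (rule T)
  show "is_proj (Y \<union> W') (tensor Y W' (sp V E W Q) R)" by (rule AR)
  \<comment> \<open>Upper bound: the product is shown to be a valid postcondition.\<close>
  have "img (Y \<union> W') (sp V E (W \<union> W') (tensor W W' Q R)) \<subseteq> img (Y \<union> W') (tensor Y W' (sp V E W Q) R)"
    unfolding sp_le_iff[OF finV finite_WW' E proj_WW' union_WW' AR] ext_WW'
  proof (rule img_tensor_subset_par_space[OF finite_YW' refl S(2) prog_YW' R S(3) A(1)])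
    show "img Y (ext W Y Q) \<subseteq> par_space Y (sop_ext V Y E) (sp V E W Q)"
      using sp_le_iff[OF finV finW E Q Y A(1)] by simp
  qed
  \<comment> \<open>Lower bound: the strongest postcondition itself is the \<open>T\<close> that has
    to contain all products of columns.\<close>
  moreover have "img (Y \<union> W') (tensor Y W' (sp V E W Q) R) \<subseteq> img (Y \<union> W') (sp V E (W \<union> W') (tensor W W' Q R))"
  proof (rule out_cols_tensor[OF finite_YW' refl S(2) prog_YW' R S(3) A T])
    show "img (Y \<union> W') (tensor Y W' (ext W Y Q) R)
      \<subseteq> par_space (Y \<union> W') (sop_ext V (Y \<union> W') E) (sp V E (W \<union> W') (tensor W W' Q R))"
      using sp_le_iff[OF finV finite_WW' E proj_WW' union_WW' T] by (simp add: ext_WW')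
  qed
  ultimately show "img (Y \<union> W') (sp V E (W \<union> W') (tensor W W' Q R)) = img (Y \<union> W') (tensor Y W' (sp V E W Q) R)"
    by (rule equalityI)
qed

end

end

theorem theorem4p10:
  fixes V W :: "nat set" and E :: sop and P Q :: op
    and xp :: "nat set \<Rightarrow> sop \<Rightarrow> nat set \<Rightarrow> op \<Rightarrow> op"
  assumes "finite V" and "E \<in> DProg V" and "finite W"
    and "is_proj W P" and "is_proj W Q"
    and "xp = wp \<or> xp = wlp"
  shows
    "(wp V E W zero_op = zero_op \<and> sp V E W zero_op = zero_op
        \<and> wlp V E W (id_op W) = ext W (V \<union> W) (id_op W))
     \<and> (proj_le W P Q \<longrightarrow>
          proj_le (V \<union> W) (xp V E W P) (xp V E W Q) \<and> proj_le (V \<union> W) (sp V E W P) (sp V E W Q))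
     \<and> xp V E W (proj_meet W P Q) = proj_meet (V \<union> W) (xp V E W P) (xp V E W Q)
     \<and> proj_le (V \<union> W) (sp V E W (proj_meet W P Q)) (proj_meet (V \<union> W) (sp V E W P) (sp V E W Q))
     \<and> proj_le (V \<union> W) (proj_join (V \<union> W) (xp V E W P) (xp V E W Q)) (xp V E W (proj_join W P Q))
     \<and> proj_join (V \<union> W) (sp V E W P) (sp V E W Q) = sp V E W (proj_join W P Q)
     \<and> (\<forall>W' R. finite W' \<and> W' \<inter> (V \<union> W) = {} \<and> is_proj W' R \<longrightarrow>
          wp V E (W \<union> W') (tensor W W' Q R) = tensor (V \<union> W) W' (wp V E W Q) R \<and>
          sp V E (W \<union> W') (tensor W W' P R) = tensor (V \<union> W) W' (sp V E W P) R \<and>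
          proj_le (V \<union> W \<union> W') (tensor (V \<union> W) W' (wlp V E W Q) R)
                  (wlp V E (W \<union> W') (tensor W W' Q R)))"
proof (intro conjI impI allI)
  note sys = assms(1,3,2) refl[of "V \<union> W"]
  show "wp V E W zero_op = zero_op" by (rule wp_zero[OF sys])
  show "sp V E W zero_op = zero_op" by (rule sp_zero[OF sys])
  show "wlp V E W (id_op W) = ext W (V \<union> W) (id_op W)" by (rule wlp_id[OF sys])
  show "xp V E W (proj_meet W P Q) = proj_meet (V \<union> W) (xp V E W P) (xp V E W Q)"
    using assms(6) wp_meet[OF sys assms(4,5)] wlp_meet[OF sys assms(4,5)] by blast
  show "proj_le (V \<union> W) (sp V E W (proj_meet W P Q)) (proj_meet (V \<union> W) (sp V E W P) (sp V E W Q))"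
    unfolding proj_le_def by (rule sp_meet_le[OF sys assms(4,5)])
  show "proj_le (V \<union> W) (proj_join (V \<union> W) (xp V E W P) (xp V E W Q)) (xp V E W (proj_join W P Q))"
    unfolding proj_le_def using assms(6) join_wp_le[OF sys assms(4,5)] join_wlp_le[OF sys assms(4,5)] by blast
  show "proj_join (V \<union> W) (sp V E W P) (sp V E W Q) = sp V E W (proj_join W P Q)"
    by (rule sp_join[OF sys assms(4,5)])
next
  note sys = assms(1,3,2) refl[of "V \<union> W"]
  assume le: "proj_le W P Q"
  show "proj_le (V \<union> W) (xp V E W P) (xp V E W Q)"
    unfolding proj_le_def using assms(6) transformers_mono(1,2)[OF sys assms(4,5) le] by blast
  show "proj_le (V \<union> W) (sp V E W P) (sp V E W Q)"
    unfolding proj_le_def by (rule transformers_mono(3)[OF sys assms(4,5) le])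
next
  note sys = assms(1,3,2) refl[of "V \<union> W"]
  fix W' R assume "finite W' \<and> W' \<inter> (V \<union> W) = {} \<and> is_proj W' R"
  then have W': "finite W'" "W' \<inter> (V \<union> W) = {}" and R: "is_proj W' R" by auto
  show "wp V E (W \<union> W') (tensor W W' Q R) = tensor (V \<union> W) W' (wp V E W Q) R"
    by (rule wp_tensor[OF sys W' assms(5) R])
  show "sp V E (W \<union> W') (tensor W W' P R) = tensor (V \<union> W) W' (sp V E W P) R"
    by (rule sp_tensor[OF sys W' assms(4) R])
  show "proj_le (V \<union> W \<union> W') (tensor (V \<union> W) W' (wlp V E W Q) R) (wlp V E (W \<union> W') (tensor W W' Q R))"
    unfolding proj_le_def by (rule wlp_tensor[OF sys W' assms(5) R])
qed

end
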